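(* Over the space $\mathcal{D}$, for every Mulholland function $\psi$, the topology generated by the Wasserstein metric $W^\psi$ is strictly finer than the topology generated by the symmetric-difference metric $V$.
   Context: Fix $n\ge 2$; $\mathbb{E}^n$ is $n$-dimensional Euclidean space with distance $d$; $v$ is $n$-dimensional volume. A region is a nonempty bounded open subset of $\mathbb{E}^n$ equal to the interior of its closure. $\mathcal{C}$ is the set of convex regions; for regions $X,Y$, $d(X,Y)=\min_{x\in\bar X,y\in\bar Y}d(x,y)$; $\mathcal{D}^2=\{X\cup Y: X,Y\in\mathcal{C},\ d(X,Y)>0\}$; $\mathcal{D}=\mathcal{C}\cup\mathcal{D}^2$. The symmetric-difference metric is $V(P,Q)=v((P\setminus Q)\cup(Q\setminus P))$. Mulholland function: a continuous, (strictly) increasing $\psi:\mathbb{R}^{\ge0}\to\mathbb{R}^{\ge0}$ with $\psi(0)=0$, $\lim_{x\to\infty}\psi(x)=\infty$, and $\psi^{-1}(\sum_{i=1}^m\psi(x_i+y_i))\le\psi^{-1}(\sum_{i=1}^m\psi(x_i))+\psi^{-1}(\sum_{i=1}^m\psi(y_i))$ for all $m$ and all $x_i,y_i\ge0$. Wasserstein metric: for a region $P$ let $U_P$ be the uniform probability distribution on $P$. For regions $P,Q$, $W^\psi(P,Q)=\inf_\gamma\psi^{-1}\left(\frac{1}{v(P)}\int_P\psi(d(x,\gamma(x)))\,dx\right)$, the infimum over all (measurable) functions $\gamma$ such that if a random variable $X$ has distribution $U_P$ then $\gamma(X)$ has distribution $U_Q$. *)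

theory Defs
  imports "HOL-Analysis.Analysis"
begin

subsection \<open>Regions\<close>

definition region :: "'a::euclidean_space set \<Rightarrow> bool" where
  "region P \<longleftrightarrow> P \<noteq> {} \<and> bounded P \<and> open P \<and> interior (closure P) = P"

definition convex_regions :: "'a::euclidean_space set set" where
  "convex_regions = {P. region P \<and> convex P}"

definition region_dist :: "'a::euclidean_space set \<Rightarrow> 'a set \<Rightarrow> real" where
  "region_dist X Y = setdist (closure X) (closure Y)"

text \<open>The infimum in \<^const>\<open>setdist\<close> is a minimum for regions.\<close>

lemma region_dist_attained:
  assumes "region X" "region Y"
  shows "\<exists>x\<in>closure X. \<exists>y\<in>closure Y. dist x y = region_dist X Y"
  using assms setdist_compact_closed[of "closure X" "closure Y"]
  unfolding region_def region_dist_def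
  by (metis closed_closure closure_eq_empty compact_closure)

definition two_convex_regions :: "'a::euclidean_space set set" where
  "two_convex_regions =
     {X \<union> Y | X Y. X \<in> convex_regions \<and> Y \<in> convex_regions \<and> region_dist X Y > 0}"

definition region_space :: "'a::euclidean_space set set" where
  "region_space = convex_regions \<union> two_convex_regions"


subsection \<open>The symmetric-difference metric\<close>

definition symdiff_dist :: "'a::euclidean_space set \<Rightarrow> 'a set \<Rightarrow> real" where
  "symdiff_dist P Q = measure lborel ((P - Q) \<union> (Q - P))"


subsection \<open>Mulholland functions and the Wasserstein metric\<close>

text \<open>A function on the nonnegative reals is represented by a function on all reals of which
  only the values on \<open>{0..}\<close> matter; its inverse is \<open>inv_into {0..}\<close>.\<close>

definition mulholland :: "(real \<Rightarrow> real) \<Rightarrow> bool" where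
  "mulholland \<psi> \<longleftrightarrow>
     \<psi> ` {0..} \<subseteq> {0..} \<and> continuous_on {0..} \<psi> \<and> strict_mono_on {0..} \<psi> \<and>
     \<psi> 0 = 0 \<and> filterlim \<psi> at_top at_top \<and>
     (\<forall>(m::nat) x y. (\<forall>i<m. 0 \<le> x i \<and> 0 \<le> y i) \<longrightarrow>
        inv_into {0..} \<psi> (\<Sum>i<m. \<psi> (x i + y i))
          \<le> inv_into {0..} \<psi> (\<Sum>i<m. \<psi> (x i)) + inv_into {0..} \<psi> (\<Sum>i<m. \<psi> (y i)))"

text \<open>Only the values on \<open>P\<close> of a transport map from \<open>P\<close> to \<open>Q\<close> matter, as every measurable
  function on \<open>P\<close> extends to a measurable function on the whole space.\<close>

definition transport_maps :: "'a::euclidean_space set \<Rightarrow> 'a set \<Rightarrow> ('a \<Rightarrow> 'a) set" where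
  "transport_maps P Q =
     {\<gamma> \<in> borel_measurable lborel.
        distr (uniform_measure lborel P) lborel \<gamma> = uniform_measure lborel Q}"

definition wasserstein :: "(real \<Rightarrow> real) \<Rightarrow> 'a::euclidean_space set \<Rightarrow> 'a set \<Rightarrow> real" where
  "wasserstein \<psi> P Q =
     (INF \<gamma>\<in>transport_maps P Q.
        inv_into {0..} \<psi> (1 / measure lborel P * (LINT x:P|lborel. \<psi> (dist x (\<gamma> x)))))"


subsection \<open>Topology generated by a metric\<close>

text \<open>This is \<^const>\<open>Metric_space.mtopology\<close> written out: the library definition can only be
  unfolded once the distance function is known to be a metric.\<close>

definition dist_topology :: "'b set \<Rightarrow> ('b \<Rightarrow> 'b \<Rightarrow> real) \<Rightarrow> 'b topology" where
  "dist_topology M d =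
     topology (\<lambda>U. U \<subseteq> M \<and> (\<forall>x\<in>U. \<exists>r>0. {y \<in> M. d x y < r} \<subseteq> U))"

lemma openin_dist_topology:
  "openin (dist_topology M d) U \<longleftrightarrow>
     U \<subseteq> M \<and> (\<forall>x\<in>U. \<exists>r>0. {y \<in> M. d x y < r} \<subseteq> U)"
proof -
  have "istopology (\<lambda>U. U \<subseteq> M \<and> (\<forall>x\<in>U. \<exists>r>0. {y \<in> M. d x y < r} \<subseteq> U))"
    unfolding istopology_def
  proof (intro conjI allI impI)
    fix S T
    assume S: "S \<subseteq> M \<and> (\<forall>x\<in>S. \<exists>r>0. {y \<in> M. d x y < r} \<subseteq> S)"
      and T: "T \<subseteq> M \<and> (\<forall>x\<in>T. \<exists>r>0. {y \<in> M. d x y < r} \<subseteq> T)"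
    show "S \<inter> T \<subseteq> M" using S by blast
    show "\<forall>x\<in>S \<inter> T. \<exists>r>0. {y \<in> M. d x y < r} \<subseteq> S \<inter> T"
    proof
      fix x assume "x \<in> S \<inter> T"
      then obtain r s where "r > 0" "{y \<in> M. d x y < r} \<subseteq> S" "s > 0" "{y \<in> M. d x y < s} \<subseteq> T"
        using S T by blast
      then have "min r s > 0 \<and> {y \<in> M. d x y < min r s} \<subseteq> S \<inter> T" by auto
      then show "\<exists>r>0. {y \<in> M. d x y < r} \<subseteq> S \<inter> T" by blast
    qed
  next
    fix K
    assume "\<forall>S\<in>K. S \<subseteq> M \<and> (\<forall>x\<in>S. \<exists>r>0. {y \<in> M. d x y < r} \<subseteq> S)"
    then show "\<Union>K \<subseteq> M" "\<forall>x\<in>\<Union>K. \<exists>r>0. {y \<in> M. d x y < r} \<subseteq> \<Union>K"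
      by (blast, meson Sup_upper2 UnionE)
  qed
  then show ?thesis
    unfolding dist_topology_def by (simp add: topology_inverse')
qed

lemma dist_topology_eq_mtopology:
  assumes "Metric_space M d"
  shows "dist_topology M d = Metric_space.mtopology M d"
proof -
  interpret Metric_space M d by fact
  have "mball x r = {y \<in> M. d x y < r}" if "x \<in> M" for x r
    using that by auto
  then show ?thesis
    unfolding topology_eq openin_dist_topology openin_mtopology
    by (metis subset_iff)
qed

definition strictly_finer :: "'b topology \<Rightarrow> 'b topology \<Rightarrow> bool" where
  "strictly_finer T T' \<longleftrightarrow> {U. openin T' U} \<subset> {U. openin T U}"

end

theory Submission
  imports Defs "HOL-Probability.Weak_Convergence"
begin

text \<open>
  A Mulholland function is superadditive, so \<open>W\<^sup>\<psi>(P, Q)\<close> small yields a transport map \<open>\<gamma>\<close> moving only a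
  small fraction of \<open>P\<close> by more than \<open>\<epsilon>\<close>. Two consequences: most of \<open>Q\<close> lies in the \<open>\<epsilon>\<close>-neighbourhood
  of \<open>P\<close>, which makes \<open>Q - P\<close> small because the boundary of \<open>P\<close> is null; and \<open>Q\<close> meets every ball of
  radius \<open>2\<epsilon>\<close> around the centre of an \<open>\<epsilon>\<close>-ball in \<open>P\<close>. Separate the two convex pieces of \<open>Q\<close> by a
  hyperplane: a point deep inside \<open>P\<close> and away from the hyperplane is surrounded by points of a single
  piece and so belongs to it by convexity, hence \<open>P - Q\<close> is contained in a thin collar and a thin slab.

  For strictness, superadditivity also gives \<open>\<psi>\<close> at least linear growth, so the centre of mass is
  \<open>W\<^sup>\<psi>\<close>-continuous. It is not \<open>V\<close>-continuous: a tiny ball placed far enough away shifts it arbitrarily.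
\<close>

subsection \<open>Mulholland functions\<close>

text \<open>Surjectivity follows from unboundedness and the intermediate value theorem. It makes
  \<open>inv_into {0..} \<psi>\<close> a true inverse on \<open>{0..}\<close> instead of an
  arbitrary choice.\<close>

lemma mulholland_bij_betw:
  assumes "mulholland \<psi>"
  shows "bij_betw \<psi> {0..} {0..}"
  unfolding bij_betw_def
proof
  have mono: "strict_mono_on {0..} \<psi>" and cont: "continuous_on {0..} \<psi>" and "\<psi> 0 = 0"
    and top: "filterlim \<psi> at_top at_top" and sub: "\<psi> ` {0..} \<subseteq> {0..}"
    using assms by (auto simp: mulholland_def)
  show "inj_on \<psi> {0..}"
    using mono by (rule strict_mono_on_imp_inj_on)
  show "\<psi> ` {0..} = {0..}"
  proof
    show "{0..} \<subseteq> \<psi> ` {0..}"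
    proof
      fix y :: real
      assume "y \<in> {0..}"
      have "eventually (\<lambda>x. \<psi> x \<ge> y \<and> x \<ge> 0) at_top"
        using top eventually_ge_at_top[of 0] by (auto simp: filterlim_at_top eventually_conj)
      then obtain b where "\<psi> b \<ge> y" "b \<ge> 0"
        by (auto simp: eventually_at_top_linorder)
      then have "\<exists>x. 0 \<le> x \<and> x \<le> b \<and> \<psi> x = y"
        using \<open>y \<in> {0..}\<close> \<open>\<psi> 0 = 0\<close> by (intro IVT' continuous_on_subset[OF cont]) auto
      then show "y \<in> \<psi> ` {0..}" by auto
    qed
  qed (fact sub)
qed

lemma mulholland_pos:
  assumes "mulholland \<psi>" "0 < x"
  shows "0 < \<psi> x"
  using assms strict_mono_onD[of "{0..}" \<psi> 0 x] by (auto simp: mulholland_def)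

lemma mulholland_nonneg:
  assumes "mulholland \<psi>" "0 \<le> x"
  shows "0 \<le> \<psi> x"
  using assms by (auto simp: mulholland_def)

lemma mulholland_mono:
  assumes "mulholland \<psi>" "0 \<le> x" "x \<le> y"
  shows "\<psi> x \<le> \<psi> y"
  using assms strict_mono_onD[of "{0..}" \<psi> x y] by (cases "x = y") (auto simp: mulholland_def)

lemma mulholland_inv_nonneg:
  assumes "mulholland \<psi>" "0 \<le> y"
  shows "0 \<le> inv_into {0..} \<psi> y" "\<psi> (inv_into {0..} \<psi> y) = y"
proof -
  have "y \<in> \<psi> ` {0..}"
    using mulholland_bij_betw[OF assms(1)] assms(2) by (simp add: bij_betw_def)
  then show "0 \<le> inv_into {0..} \<psi> y" "\<psi> (inv_into {0..} \<psi> y) = y"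
    using inv_into_into[of y \<psi> "{0..}"] f_inv_into_f[of y \<psi> "{0..}"] by auto
qed

lemma mulholland_inv_less:
  assumes "mulholland \<psi>" "0 \<le> y" "inv_into {0..} \<psi> y < s"
  shows "y < \<psi> s"
  using strict_mono_onD[of "{0..}" \<psi> "inv_into {0..} \<psi> y" s] mulholland_inv_nonneg[OF assms(1,2)] assms
  by (auto simp: mulholland_def)

text \<open>The Mulholland inequality for the pairs \<open>(a, 0)\<close> and \<open>(0, b)\<close>.\<close>

lemma mulholland_superadditive:
  assumes \<psi>: "mulholland \<psi>" and "0 \<le> a" "0 \<le> b"
  shows "\<psi> a + \<psi> b \<le> \<psi> (a + b)"
proof -
  have inv: "inv_into {0..} \<psi> (\<psi> t) = t" if "0 \<le> t" for t
    using mulholland_bij_betw[OF \<psi>] that by (intro inv_into_f_f) (auto simp: bij_betw_def)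
  have "\<psi> 0 = 0" using \<psi> by (simp add: mulholland_def)
  define x y where "x = (\<lambda>i::nat. if i = 0 then a else 0)" and "y = (\<lambda>i::nat. if i = 0 then 0 else b)"
  have "inv_into {0..} \<psi> (\<Sum>i<2. \<psi> (x i + y i))
      \<le> inv_into {0..} \<psi> (\<Sum>i<2. \<psi> (x i)) + inv_into {0..} \<psi> (\<Sum>i<2. \<psi> (y i))"
  proof -
    have "\<forall>i<2. 0 \<le> x i \<and> 0 \<le> y i" using assms by (simp add: x_def y_def)
    with \<psi> show ?thesis unfolding mulholland_def by blast
  qed
  then have le: "inv_into {0..} \<psi> (\<psi> a + \<psi> b) \<le> a + b"
    using assms \<open>\<psi> 0 = 0\<close> by (simp add: x_def y_def numeral_2_eq_2 inv)
  have "0 \<le> \<psi> a + \<psi> b" using assms mulholland_nonneg by (metis add_nonneg_nonneg)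
  note i = mulholland_inv_nonneg[OF \<psi> this]
  show ?thesis
    using mulholland_mono[OF \<psi> i(1) le] i(2) by simp
qed

lemma mulholland_multiple:
  assumes "mulholland \<psi>" "0 \<le> a"
  shows "real k * \<psi> a \<le> \<psi> (real k * a)"
proof (induction k)
  case 0
  then show ?case using assms by (simp add: mulholland_def)
next
  case (Suc k)
  then show ?case
    using mulholland_superadditive[of \<psi> "real k * a" a] assms by (simp add: algebra_simps)
qed

text \<open>The distance \<open>d\<close> contains \<open>k\<close>, the floor of
  \<open>d / \<epsilon>\<close>, full steps of length \<open>\<epsilon>\<close>, so superadditivity
  gives \<open>k * \<psi> \<epsilon> \<le> \<psi> d\<close>. Mean cost thereby controls mean
  displacement.\<close>

lemma mulholland_linear_growth:
  assumes \<psi>: "mulholland \<psi>" and "0 < \<epsilon>" "0 \<le> d"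
  shows "d \<le> \<epsilon> + \<epsilon> * (\<psi> d / \<psi> \<epsilon>)"
proof -
  define k where "k = nat \<lfloor>d / \<epsilon>\<rfloor>"
  have k: "real k \<le> d / \<epsilon>" "d / \<epsilon> \<le> real k + 1"
  proof -
    have "real k = of_int \<lfloor>d / \<epsilon>\<rfloor>" using assms by (simp add: k_def)
    then show "real k \<le> d / \<epsilon>" "d / \<epsilon> \<le> real k + 1" by linarith+
  qed
  have "real k * \<psi> \<epsilon> \<le> \<psi> (real k * \<epsilon>)"
    using assms by (intro mulholland_multiple) auto
  also have "\<dots> \<le> \<psi> d"
  proof (rule mulholland_mono[OF \<psi>])
    show "0 \<le> real k * \<epsilon>" using \<open>0 < \<epsilon>\<close> by simp
    show "real k * \<epsilon> \<le> d" using k(1) \<open>0 < \<epsilon>\<close> by (simp only: pos_le_divide_eq)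
  qed
  finally have "real k \<le> \<psi> d / \<psi> \<epsilon>"
    using mulholland_pos[OF \<psi> \<open>0 < \<epsilon>\<close>] by (simp add: pos_le_divide_eq)
  then have "d / \<epsilon> \<le> 1 + \<psi> d / \<psi> \<epsilon>" using k by linarith
  then have "d \<le> (1 + \<psi> d / \<psi> \<epsilon>) * \<epsilon>" using \<open>0 < \<epsilon>\<close> by (simp add: pos_divide_le_eq)
  then show ?thesis by (simp add: algebra_simps)
qed

text \<open>Turns a bound \<open>\<epsilon> / k\<close> on the Wasserstein distance into a mean cost
  below \<open>\<psi> \<epsilon> / k\<close>, the form in which Markov's inequality is
  applied.\<close>

lemma mulholland_divide:
  assumes \<psi>: "mulholland \<psi>" and "0 \<le> \<epsilon>" "0 < N"
  shows "\<psi> (\<epsilon> / real N) \<le> \<psi> \<epsilon> / real N"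
  using mulholland_multiple[OF \<psi>, of "\<epsilon> / real N" N] assms by (simp add: pos_le_divide_eq mult.commute)

subsection \<open>Transporting a distribution with continuous distribution function\<close>

text \<open>The probability integral transform: a continuous distribution function carries its own
  law to the uniform law on the unit interval.\<close>

lemma (in cdf_distribution) measure_cdf_le:
  assumes "\<And>x. isCont (cdf M) x" "0 < u" "u < 1"
  shows "measure M {x. cdf M x \<le> u} = u"
proof -
  \<comment> \<open>The sublevel set is closed and bounded above, hence the half-line up to its
    supremum \<open>m\<close>. The value \<open>u\<close> is attained by the intermediate value
    theorem, so \<open>cdf M m = u\<close>.\<close>
  define m where "m = Sup {x. cdf M x \<le> u}"
  have mono: "cdf M x \<le> cdf M y" if "x \<le> y" for x y
    using that by (rule cdf_nondecreasing)
  have "eventually (\<lambda>x. cdf M x > u) at_top"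
    using cdf_lim_at_top_prob \<open>u < 1\<close> by (rule order_tendstoD)
  then obtain b where b: "cdf M b > u"
    by (auto simp: eventually_at_top_linorder)
  have "eventually (\<lambda>x. cdf M x < u) at_bot"
    using cdf_lim_at_bot \<open>u > 0\<close> by (rule order_tendstoD)
  then obtain a where a: "cdf M a < u"
    by (auto simp: eventually_at_bot_linorder)
  have "a \<le> b" using mono[of b a] a b by linarith
  then have "\<exists>x. a \<le> x \<and> x \<le> b \<and> cdf M x = u"
    using a b assms(1) by (intro IVT) auto
  then obtain x0 where x0: "cdf M x0 = u" by blast
  have bdd: "bdd_above {x. cdf M x \<le> u}"
    using mono b by (intro bdd_aboveI[of _ b]) (metis linear mem_Collect_eq not_le order_trans)
  have "closed {x. cdf M x \<le> u}"
    using assms(1) by (intro closed_Collect_le continuous_intros) (auto simp: continuous_on_eq_continuous_at)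
  then have "m \<in> {x. cdf M x \<le> u}"
    unfolding m_def using bdd x0 by (intro closed_contains_Sup) auto
  moreover have "x \<le> m" if "cdf M x \<le> u" for x
    unfolding m_def using that bdd by (intro cSup_upper) auto
  ultimately have "{x. cdf M x \<le> u} = {..m}" "cdf M m = u"
    using mono x0 by (auto intro: order_trans) (metis eq_iff order_refl)
  then show ?thesis by (simp add: cdf_def)
qed

text \<open>The map is the probability integral transform of \<open>M\<close> followed by the
  quantile function of \<open>N\<close>.\<close>

lemma ex_distr_eq_of_continuous_cdf:
  assumes "real_distribution M" "real_distribution N" "\<And>x. isCont (cdf M) x"
  shows "\<exists>h\<in>borel_measurable borel. distr M borel h = N"
proof -
  interpret M: cdf_distribution M using assms(1) by (simp add: cdf_distribution_def)
  interpret N: cdf_distribution N using assms(2) by (simp add: cdf_distribution_def)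
  let ?F = "cdf M" and ?G = "cdf N"
  \<comment> \<open>\<open>N.I\<close> is the quantile function on the open unit interval. The value
    0 elsewhere is a harmless default, since \<open>cdf M\<close> lies strictly between 0 and 1
    almost everywhere.\<close>
  define h where "h = (\<lambda>x. if ?F x \<in> {0<..<1} then N.I (?F x) else 0)"
  have le: "measure M {x. ?F x \<le> u} = u" if "0 < u" "u < 1" for u
    using M.measure_cdf_le[OF assms(3) that] .
  have [measurable]: "h \<in> borel_measurable borel"
  proof -
    have "(\<lambda>u. if u \<in> {0<..<1} then N.I u else 0) \<in> borel_measurable borel"
      using N.measurable_CI by (subst (asm) measurable_restrict_space_iff[where c=0]) auto
    from measurable_compose[OF M.measurable_C this] show ?thesis by (simp add: h_def)
  qed
  have zero: "measure M {x. ?F x \<le> 0} = 0"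
  proof -
    have *: "measure M {x. ?F x \<le> 0} \<le> u" if "0 < u" "u < 1" for u
      using le[OF that] that by (subst le[OF that, symmetric], intro M.finite_measure_mono) auto
    then have "measure M {x. ?F x \<le> 0} \<le> 0 + e" if "e > 0" for e
      using *[of "min e (1/2)"] that by linarith
    then show ?thesis using field_le_epsilon[of "measure M {x. ?F x \<le> 0}" 0] by (simp add: measure_le_0_iff)
  qed
  have one: "measure M {x. 1 \<le> ?F x} = 0"
  proof -
    have *: "measure M {x. 1 \<le> ?F x} \<le> 1 - u" if "0 < u" "u < 1" for u
    proof -
      have "measure M {x. 1 \<le> ?F x} \<le> measure M (space M - {x. ?F x \<le> u})"
        using that by (intro M.finite_measure_mono) auto
      also have "\<dots> = 1 - u" using le[OF that] by (subst M.prob_compl) auto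
      finally show ?thesis .
    qed
    then have "measure M {x. 1 \<le> ?F x} \<le> 0 + e" if "e > 0" for e
      using *[of "1 - min e (1/2)"] that by linarith
    then show ?thesis using field_le_epsilon[of "measure M {x. 1 \<le> ?F x}" 0] by (simp add: measure_le_0_iff)
  qed
  have "AE x in M. ?F x \<in> {0<..<1}"
  proof -
    have "AE x in M. x \<notin> {x. ?F x \<le> 0}" "AE x in M. x \<notin> {x. 1 \<le> ?F x}"
      using zero one by (subst M.prob_eq_0[symmetric]; simp)+
    then show ?thesis by eventually_elim auto
  qed
  \<comment> \<open>The endpoints are included because \<open>?G t\<close> may equal 0 or 1.\<close>
  have le': "measure M {x. ?F x \<le> u} = u" if "0 \<le> u" "u \<le> 1" for u
  proof -
    have "{x. ?F x \<le> 1} = space M" using M.cdf_bounded_prob by auto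
    then have "measure M {x. ?F x \<le> 1} = 1" using M.prob_space by simp
    then show ?thesis using that zero le by (cases "u = 0"; cases "u = 1") auto
  qed
  have "distr M borel h = N"
  proof (rule cdf_unique)
    show "real_distribution (distr M borel h)" by simp
    show "cdf (distr M borel h) = ?G"
    proof
      fix t
      have "cdf (distr M borel h) t = measure M {x. h x \<le> t}"
        by (simp add: cdf_def measure_distr vimage_def)
      also have "\<dots> = measure M {x. ?F x \<le> ?G t}"
      proof (rule M.finite_measure_eq_AE)
        show "AE x in M. (x \<in> {x. h x \<le> t}) = (x \<in> {x. ?F x \<le> ?G t})"
          using \<open>AE x in M. ?F x \<in> {0<..<1}\<close>
          by eventually_elim (auto simp: h_def N.pseudoinverse[symmetric])
      qed measurable
      also have "\<dots> = ?G t"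
        by (intro le' N.cdf_nonneg N.cdf_bounded_prob)
      finally show "cdf (distr M borel h) t = ?G t" .
    qed
  qed fact
  then show ?thesis by (intro bexI[of _ h]) auto
qed

subsection \<open>Measurable encoding of bounded sets of vectors by real numbers\<close>

text \<open>The coefficient of the negative power \<open>k + 1\<close> of \<open>p\<close> in the
  base-\<open>p\<close> expansion of the fractional part of \<open>t\<close>. Written with floors,
  it is visibly Borel measurable.\<close>

definition digit :: "nat \<Rightarrow> nat \<Rightarrow> real \<Rightarrow> real" where
  "digit p k t = of_int \<lfloor>real p ^ Suc k * t\<rfloor> - real p * of_int \<lfloor>real p ^ k * t\<rfloor>"

lemma borel_measurable_digit [measurable]: "digit p k \<in> borel_measurable borel"
  unfolding digit_def by measurable

lemma binary_digit_cases: "digit 2 k t = 0 \<or> digit 2 k t = 1"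
proof -
  have "\<lfloor>2 * (2 ^ k * t)\<rfloor> = 2 * \<lfloor>2 ^ k * t\<rfloor> \<or> \<lfloor>2 * (2 ^ k * t)\<rfloor> = 2 * \<lfloor>2 ^ k * t\<rfloor> + 1"
    by linarith
  then show ?thesis by (auto simp: digit_def mult.assoc)
qed

text \<open>The partial sums telescope to \<open>\<lfloor>2 ^ n * t\<rfloor> / 2 ^ n\<close>, which
  differs from \<open>t\<close> by at most \<open>(1/2) ^ n\<close>.\<close>

lemma binary_digit_sums:
  assumes "0 \<le> t" "t < 1"
  shows "(\<lambda>k. digit 2 k t / 2 ^ Suc k) sums t"
proof -
  have "(\<Sum>k<n. digit 2 k t / 2 ^ Suc k) = of_int \<lfloor>2 ^ n * t\<rfloor> / 2 ^ n" for n
  proof (induction n)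
    case 0
    then show ?case using assms by simp linarith
  next
    case (Suc n)
    then show ?case by (simp add: digit_def field_simps)
  qed
  moreover have "(\<lambda>n. of_int \<lfloor>2 ^ n * t\<rfloor> / 2 ^ n) \<longlonglongrightarrow> t"
  proof (rule tendsto_sandwich)
    show "\<forall>\<^sub>F n in sequentially. t - (1/2) ^ n \<le> of_int \<lfloor>2 ^ n * t\<rfloor> / 2 ^ n"
    proof (rule always_eventually, rule allI)
      fix n
      have "2 ^ n * t - 1 \<le> of_int \<lfloor>2 ^ n * t\<rfloor>" by linarith
      then have "(2 ^ n * t - 1) / 2 ^ n \<le> of_int \<lfloor>2 ^ n * t\<rfloor> / 2 ^ n"
        by (rule divide_right_mono) simp
      then show "t - (1/2) ^ n \<le> of_int \<lfloor>2 ^ n * t\<rfloor> / 2 ^ n"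
        by (simp add: diff_divide_distrib power_divide)
    qed
    show "\<forall>\<^sub>F n in sequentially. of_int \<lfloor>2 ^ n * t\<rfloor> / 2 ^ n \<le> t"
      by (simp add: field_simps)
    have "(\<lambda>n. t - (1/2) ^ n) \<longlonglongrightarrow> t - 0"
      by (intro tendsto_intros LIMSEQ_power_zero) auto
    then show "(\<lambda>n. t - (1/2) ^ n) \<longlonglongrightarrow> t" by simp
  qed simp
  ultimately show ?thesis by (simp add: sums_def)
qed

text \<open>Base \<open>3\<close> with digits \<open>0\<close> and \<open>1\<close> only, so that expansions are unique.\<close>

lemma digit_ternary_sum:
  assumes b: "\<And>k. b k \<in> {0, 1::real}"
  shows "digit 3 n (\<Sum>k. b k / 3 ^ Suc k) = b n"
proof -
  let ?g = "\<Sum>k. b k / 3 ^ Suc k"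
  have geo: "(\<lambda>k. (1/3) * (1/3::real) ^ k) sums ((1/3) * (1 / (1 - 1/3)))"
    by (intro sums_mult geometric_sums) auto
  have bound: "norm (c k / 3 ^ Suc k) \<le> (1/3) * (1/3) ^ k" if "\<forall>k. c k \<in> {0,1}" for c :: "nat \<Rightarrow> real" and k
    using that[rule_format, of k] by (auto simp: power_divide)
  have summ: "summable (\<lambda>k. c k / 3 ^ Suc k)" if "\<forall>k. c k \<in> {0,1}" for c :: "nat \<Rightarrow> real"
    by (rule summable_comparison_test'[OF sums_summable[OF geo], of 0]) (rule bound[OF that])
  \<comment> \<open>With digits 0 and 1 in base 3 every tail is at most 1/2. Being strictly below 1,
    it cannot carry into earlier digits.\<close>
  have tail: "0 \<le> (\<Sum>k. c k / 3 ^ Suc k)" "(\<Sum>k. c k / 3 ^ Suc k) < 1"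
    if "\<forall>k. c k \<in> {0,1}" for c :: "nat \<Rightarrow> real"
  proof -
    show "0 \<le> (\<Sum>k. c k / 3 ^ Suc k)"
    proof (rule suminf_nonneg[OF summ[OF that]])
      show "0 \<le> c k / 3 ^ Suc k" for k using that[rule_format, of k] by auto
    qed
    have "(\<Sum>k. c k / 3 ^ Suc k) \<le> (\<Sum>k. (1/3) * (1/3) ^ k)"
    proof (rule suminf_le[OF _ summ[OF that] sums_summable[OF geo]])
      show "c k / 3 ^ Suc k \<le> (1/3) * (1/3) ^ k" for k using bound[OF that, of k] by (simp only: real_norm_def abs_le_iff)
    qed
    also have "\<dots> = 1/2" using sums_unique[OF geo] by simp
    finally show "(\<Sum>k. c k / 3 ^ Suc k) < 1" by simp
  qed
  have "\<exists>S::int. of_int S = (\<Sum>k<n. b k * 3 ^ (n - Suc k))" for n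
  proof -
    have "b k \<in> \<int>" for k using b[of k] by auto
    then have "(\<Sum>k<n. b k * 3 ^ (n - Suc k)) \<in> \<int>" by (intro Ints_sum Ints_mult) auto
    then show ?thesis by (auto elim!: Ints_cases)
  qed
  then obtain S :: "nat \<Rightarrow> int" where S: "\<And>n. of_int (S n) = (\<Sum>k<n. b k * 3 ^ (n - Suc k))"
    by metis
  \<comment> \<open>Scaling by \<open>3 ^ n\<close> splits the series into the integer
    \<open>S n\<close> formed by the first \<open>n\<close> digits and a tail in
    \<open>[0, 1)\<close>.\<close>
  have floor: "\<lfloor>3 ^ n * ?g\<rfloor> = S n" for n
  proof -
    have "?g = (\<Sum>k. b (k + n) / 3 ^ Suc (k + n)) + (\<Sum>k<n. b k / 3 ^ Suc k)"
      using summ[of b] b by (intro suminf_split_initial_segment) auto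
    then have "3 ^ n * ?g = 3 ^ n * (\<Sum>k. b (k + n) / 3 ^ Suc (k + n)) + (\<Sum>k<n. 3 ^ n * (b k / 3 ^ Suc k))"
      by (simp only: distrib_left sum_distrib_left)
    also have "3 ^ n * (\<Sum>k. b (k + n) / 3 ^ Suc (k + n)) = (\<Sum>k. b (k + n) / 3 ^ Suc k)"
    proof -
      have "(\<Sum>k. b (k + n) / 3 ^ Suc (k + n)) = (\<Sum>k. (1 / 3 ^ n) * (b (k + n) / 3 ^ Suc k))"
        by (simp add: power_add field_simps)
      also have "\<dots> = (1 / 3 ^ n) * (\<Sum>k. b (k + n) / 3 ^ Suc k)"
        using summ[of "\<lambda>k. b (k + n)"] b by (intro suminf_mult) auto
      finally show ?thesis by simp
    qed
    also have "(\<Sum>k<n. 3 ^ n * (b k / 3 ^ Suc k)) = of_int (S n)"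
      unfolding S
    proof (rule sum.cong)
      fix k assume "k \<in> {..<n}"
      then have "(3::real) ^ n = 3 ^ Suc k * 3 ^ (n - Suc k)"
        by (simp only: power_add[symmetric]) simp
      then show "3 ^ n * (b k / 3 ^ Suc k) = b k * 3 ^ (n - Suc k)" by simp
    qed simp
    finally show ?thesis
      using tail[of "\<lambda>k. b (k + n)"] b by (simp add: floor_unique)
  qed
  have "real_of_int (S (Suc n)) = 3 * of_int (S n) + b n"
  proof -
    have "(\<Sum>k<n. b k * 3 ^ (n - k)) = 3 * (\<Sum>k<n. b k * 3 ^ (n - Suc k))"
      unfolding sum_distrib_left
    proof (rule sum.cong)
      fix k assume "k \<in> {..<n}"
      then have "n - k = Suc (n - Suc k)" by auto
      then show "b k * 3 ^ (n - k) = 3 * (b k * 3 ^ (n - Suc k))" by simp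
    qed simp
    then show ?thesis by (simp add: S)
  qed
  then show ?thesis by (simp only: digit_def floor of_nat_numeral)
qed

text \<open>The coordinates are rescaled into the unit interval, and all their binary digits are
  interleaved as ternary digits of one real. Decoding reads them back. This reduces transport onto a
  set of vectors to transport on the line.\<close>

lemma ex_measurable_encoding:
  fixes Q :: "'a::euclidean_space set"
  assumes "bounded Q"
  shows "\<exists>g\<in>borel_measurable borel. \<exists>f\<in>borel_measurable borel. \<forall>x\<in>Q. f (g x :: real) = x"
proof -
  obtain R where R: "0 < R" "\<And>x. x \<in> Q \<Longrightarrow> norm x < R"
    using assms by (auto simp: bounded_pos_less)
  define t :: "'a \<Rightarrow> 'a \<Rightarrow> real" where "t i x = (x \<bullet> i + R) / (2 * R)" for i x
  define I :: "('a \<times> nat) set" where "I = Basis \<times> UNIV"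
  have I: "countable I"
    unfolding I_def by (intro countable_SIGMA countableI_type) (simp add: countable_finite)
  \<comment> \<open>\<open>\<phi>\<close> enumerates the pairs of a coordinate direction and a digit
    position; \<open>\<nu>\<close> gives the place at which such a pair is stored.\<close>
  define \<phi> where "\<phi> = from_nat_into I"
  define \<nu> where "\<nu> = to_nat_on I"
  define g where "g x = (\<Sum>k. digit 2 (snd (\<phi> k)) (t (fst (\<phi> k)) x) / 3 ^ Suc k)" for x
  define f where "f y = (\<Sum>i\<in>Basis. (2 * R * (\<Sum>j. digit 3 (\<nu> (i, j)) y / 2 ^ Suc j) - R) *\<^sub>R i)" for y
  have "f (g x) = x" if "x \<in> Q" for x
  proof (rule euclidean_eqI)
    fix i :: 'a assume i: "i \<in> Basis"
    have d: "digit 3 (\<nu> (i, j)) (g x) = digit 2 j (t i x)" for j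
    proof -
      have "\<phi> (\<nu> (i, j)) = (i, j)"
        unfolding \<phi>_def \<nu>_def using i I by (intro from_nat_into_to_nat_on) (auto simp: I_def)
      then show ?thesis
        unfolding g_def using binary_digit_cases by (subst digit_ternary_sum) auto
    qed
    have "\<bar>x \<bullet> i\<bar> < R" using R(2)[OF that] Basis_le_norm[OF i, of x] by linarith
    then have "0 \<le> t i x" "t i x < 1" using R(1) by (auto simp: t_def field_simps)
    then have s: "(\<Sum>j. digit 2 j (t i x) / 2 ^ Suc j) = t i x"
      using binary_digit_sums sums_unique by metis
    have "f (g x) \<bullet> i = 2 * R * t i x - R"
      using i by (simp only: f_def inner_sum_left_Basis d s)
    then show "f (g x) \<bullet> i = x \<bullet> i"
      using R(1) by (simp add: t_def)
  qed
  moreover have "g \<in> borel_measurable borel"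
  proof -
    have [measurable]: "t i \<in> borel_measurable borel" for i
      unfolding t_def by measurable
    show ?thesis unfolding g_def by measurable
  qed
  moreover have "f \<in> borel_measurable borel"
    unfolding f_def by measurable
  ultimately show ?thesis by blast
qed

subsection \<open>Uniform distributions on bounded open sets\<close>

text \<open>These properties give \<open>P\<close> positive finite volume, so its uniform measure is
  a probability measure. Every member of \<open>region_space\<close> has them.\<close>

locale bounded_open =
  fixes P :: "'a::euclidean_space set"
  assumes open_P: "open P" and bounded_P: "bounded P" and nonempty: "P \<noteq> {}"
begin

abbreviation U :: "'a measure" where "U \<equiv> uniform_measure lborel P"

abbreviation vol :: real where "vol \<equiv> measure lborel P"

lemma sets_P [measurable]: "P \<in> sets borel"
  using open_P by simp

lemma emeasure_P: "emeasure lborel P \<noteq> 0" "emeasure lborel P \<noteq> \<infinity>"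
proof -
  have "P \<notin> null_sets lebesgue"
    using open_not_negligible[OF open_P nonempty] by (simp add: negligible_iff_null_sets)
  then show "emeasure lborel P \<noteq> 0"
    by (auto simp: null_sets_def)
  show "emeasure lborel P \<noteq> \<infinity>"
    using emeasure_bounded_finite[OF bounded_P] by simp
qed

lemma vol_pos: "0 < vol"
  using emeasure_P by (simp add: measure_def enn2real_positive_iff less_top zero_less_iff_neq_zero)

sublocale prob_space U
  using emeasure_P by (rule prob_space_uniform_measure)

lemma AE_mem: "AE x in U. x \<in> P"
  by (rule AE_uniform_measureI) auto

lemma prob_eq: "A \<in> sets borel \<Longrightarrow> prob A = measure lborel (P \<inter> A) / vol"
  using emeasure_P by (subst measure_uniform_measure) auto

text \<open>Identifies the averaged integral in \<open>wasserstein\<close> with an expectation, so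
  that probabilistic inequalities apply to it.\<close>

lemma expectation_eq:
  fixes f :: "'a \<Rightarrow> real"
  assumes [measurable]: "f \<in> borel_measurable borel"
  shows "expectation f = 1 / vol * (LINT x:P|lborel. f x)"
proof -
  have U: "U = density lborel (\<lambda>x. ennreal (indicator P x / vol))"
    unfolding uniform_measure_def
  proof (rule density_cong)
    show "AE x in lborel. indicator P x / emeasure lborel P = ennreal (indicator P x / vol)"
      using vol_pos emeasure_P
      by (intro AE_I2) (auto simp: emeasure_eq_ennreal_measure divide_ennreal ennreal_1[symmetric]
          simp del: ennreal_1 split: split_indicator)
  qed measurable
  show "expectation f = 1 / vol * (LINT x:P|lborel. f x)"
    using vol_pos unfolding U set_lebesgue_integral_def
    by (subst integral_real_density) (auto simp flip: integral_mult_right_zero intro!: Bochner_Integration.integral_cong)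
qed

lemma integrable_bounded:
  fixes f :: "'a \<Rightarrow> real"
  assumes "f \<in> borel_measurable borel" "AE x in U. \<bar>f x\<bar> \<le> B"
  shows "integrable U f"
  using assms by (intro integrable_const_bound[where B=B]) auto

end

text \<open>\<^const>\<open>wasserstein\<close> takes an arbitrary value where the infimum is over the empty set, so the
  existence of a transport map is essential.\<close>

lemma transport_maps_nonempty:
  fixes P Q :: "'a::euclidean_space set"
  assumes "bounded_open P" "bounded_open Q"
  shows "transport_maps P Q \<noteq> {}"
proof -
  interpret P: bounded_open P by fact
  interpret Q: bounded_open Q by fact
  obtain g :: "'a \<Rightarrow> real" and f where [measurable]: "g \<in> borel_measurable borel" "f \<in> borel_measurable borel"
    and fg: "\<And>x. x \<in> Q \<Longrightarrow> f (g x) = x"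
    using ex_measurable_encoding[OF Q.bounded_P] by blast
  obtain e :: 'a where e: "e \<in> Basis" using nonempty_Basis by blast
  \<comment> \<open>One coordinate of the source carries enough randomness: its law \<open>M\<close>
    is transported on the line to the law \<open>N\<close> of the codes of points of
    \<open>Q\<close>, and decoding then produces the uniform law on \<open>Q\<close>.\<close>
  define M where "M = distr P.U borel (\<lambda>x. x \<bullet> e)"
  define N where "N = distr Q.U borel g"
  have M: "real_distribution M"
    unfolding M_def by (intro P.real_distribution_distr) simp
  have N: "real_distribution N"
    unfolding N_def by (intro Q.real_distribution_distr) simp
  \<comment> \<open>\<open>M\<close> has no atoms because hyperplanes orthogonal to \<open>e\<close>
    are null.\<close>
  have "isCont (cdf M) t" for t
  proof -
    interpret M: real_distribution M by fact
    have "AE x in P.U. x \<bullet> e \<noteq> t"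
      using AE_lborel_inner_neq[OF e, of t] by (intro AE_uniform_measureI) auto
    then have "AE y in M. y \<notin> {t}"
      unfolding M_def by (subst AE_distr_iff) auto
    then have "measure M {t} = 0"
      by (subst M.prob_eq_0) auto
    then show ?thesis by (simp add: M.isCont_cdf)
  qed
  then obtain h where [measurable]: "h \<in> borel_measurable borel" and h: "distr M borel h = N"
    using ex_distr_eq_of_continuous_cdf[OF M N] by blast
  have "distr P.U borel (\<lambda>x. f (h (x \<bullet> e))) = distr (distr M borel h) borel f"
    unfolding M_def by (subst distr_distr, simp, simp)+ (simp add: comp_def)
  also have "\<dots> = distr Q.U borel (\<lambda>x. f (g x))"
    unfolding h N_def by (subst distr_distr) (auto simp: comp_def)
  also have "\<dots> = distr Q.U Q.U (\<lambda>x. x)"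
    using Q.AE_mem by (intro distr_cong_AE) (auto elim!: eventually_mono simp: fg)
  also have "\<dots> = Q.U" by (rule distr_id)
  finally have "distr P.U lborel (\<lambda>x. f (h (x \<bullet> e))) = Q.U"
    by (simp cong: distr_cong)
  then have "(\<lambda>x. f (h (x \<bullet> e))) \<in> transport_maps P Q"
    by (simp add: transport_maps_def)
  then show ?thesis by blast
qed

section \<open>Transport maps of small cost\<close>

lemma mulholland_borel_measurable:
  assumes "mulholland \<psi>" and [measurable]: "f \<in> borel_measurable M" and "\<And>x. 0 \<le> f x"
  shows "(\<lambda>x. \<psi> (f x)) \<in> borel_measurable M"
proof -
  have "continuous_on {0..} \<psi>" using assms(1) by (simp add: mulholland_def)
  \<comment> \<open>The values of \<open>\<psi>\<close> at negative arguments are unconstrained.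
    Composing with \<open>max 0\<close> gives a function continuous everywhere with the same values
    on the range of \<open>f\<close>.\<close>
  then have "continuous_on UNIV (\<lambda>t. \<psi> (max 0 t))"
    by (rule continuous_on_compose2) (auto intro!: continuous_intros)
  then have [measurable]: "(\<lambda>t. \<psi> (max 0 t)) \<in> borel_measurable borel"
    by (rule borel_measurable_continuous_onI)
  have "(\<lambda>x. \<psi> (max 0 (f x))) \<in> borel_measurable M" by measurable
  then show ?thesis using assms(3) by (simp add: max_absorb2)
qed

text \<open>The infimum runs over a nonempty set, so some map beats any bound above it.
  Superadditivity then restates its cost relative to the threshold
  \<open>\<psi> \<epsilon>\<close>.\<close>

lemma cheap_transport_map:
  fixes P Q :: "'a::euclidean_space set"
  assumes \<psi>: "mulholland \<psi>" and "bounded_open P" "bounded_open Q"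
    and W: "wasserstein \<psi> P Q < \<epsilon> / real k" and "0 < \<epsilon>" "0 < k"
  obtains \<gamma> where "\<gamma> \<in> borel_measurable borel"
    and "distr (uniform_measure lborel P) borel \<gamma> = uniform_measure lborel Q"
    and "AE x in uniform_measure lborel P. \<gamma> x \<in> Q"
    and "integrable (uniform_measure lborel P) (\<lambda>x. \<psi> (dist x (\<gamma> x)))"
    and "(LINT x|uniform_measure lborel P. \<psi> (dist x (\<gamma> x))) < \<psi> \<epsilon> / real k"
proof -
  interpret P: bounded_open P by fact
  interpret Q: bounded_open Q by fact
  obtain \<gamma> where \<gamma>: "\<gamma> \<in> transport_maps P Q"
    and less: "inv_into {0..} \<psi> (1 / P.vol * (LINT x:P|lborel. \<psi> (dist x (\<gamma> x)))) < \<epsilon> / real k"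
    using cInf_lessD[OF _ W[unfolded wasserstein_def]] transport_maps_nonempty[OF assms(2,3)] by blast
  have [measurable]: "\<gamma> \<in> borel_measurable borel"
    using \<gamma> by (simp add: transport_maps_def)
  have distr: "distr P.U borel \<gamma> = Q.U"
    using \<gamma> by (simp add: transport_maps_def cong: distr_cong)
  have cost [measurable]: "(\<lambda>x. \<psi> (dist x (\<gamma> x))) \<in> borel_measurable borel"
    by (intro mulholland_borel_measurable[OF \<psi>]) auto
  have AE: "AE x in P.U. \<gamma> x \<in> Q"
    using Q.AE_mem unfolding distr[symmetric] by (subst (asm) AE_distr_iff) auto
  \<comment> \<open>Both sets are bounded, so the cost is bounded and hence integrable. This rules
    out the default value 0 of the integral, for which a small mean would say nothing.\<close>
  define B where "B = diameter (P \<union> Q)"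
  have B: "dist x y \<le> B" if "x \<in> P" "y \<in> Q" for x y
    unfolding B_def using that P.bounded_P Q.bounded_P by (intro diameter_bounded_bound) auto
  have "AE x in P.U. \<bar>\<psi> (dist x (\<gamma> x))\<bar> \<le> \<psi> B"
    using P.AE_mem AE
    by eventually_elim (auto intro!: mulholland_mono[OF \<psi>] B simp: abs_of_nonneg mulholland_nonneg[OF \<psi>])
  then have "integrable P.U (\<lambda>x. \<psi> (dist x (\<gamma> x)))"
    by (intro P.integrable_bounded) auto
  have nonneg: "0 \<le> P.expectation (\<lambda>x. \<psi> (dist x (\<gamma> x)))"
    by (intro integral_nonneg_AE) (auto simp: mulholland_nonneg[OF \<psi>])
  have "P.expectation (\<lambda>x. \<psi> (dist x (\<gamma> x))) < \<psi> (\<epsilon> / real k)"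
    using less nonneg P.expectation_eq[OF cost] by (intro mulholland_inv_less[OF \<psi>]) auto
  also have "\<dots> \<le> \<psi> \<epsilon> / real k"
    using assms by (intro mulholland_divide) auto
  finally show thesis
    by (intro that[OF _ distr AE \<open>integrable P.U _\<close>]) auto
qed

subsection \<open>Volumes of collars and slabs\<close>

definition nbhd :: "real \<Rightarrow> 'a::metric_space set \<Rightarrow> 'a set" where
  "nbhd \<epsilon> P = (\<Union>x\<in>P. ball x \<epsilon>)"

text \<open>The inner parallel set, dual to \<open>nbhd\<close>: its complement is the
  \<open>\<delta>\<close>-neighbourhood of \<open>- P\<close>.\<close>

definition core :: "real \<Rightarrow> 'a::metric_space set \<Rightarrow> 'a set" where
  "core \<delta> P = {x. ball x \<delta> \<subseteq> P}"

lemma open_nbhd: "open (nbhd \<epsilon> P)"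
  unfolding nbhd_def by blast

lemma nbhd_mono: "\<epsilon> \<le> \<epsilon>' \<Longrightarrow> nbhd \<epsilon> P \<subseteq> nbhd \<epsilon>' P"
  by (auto simp: nbhd_def intro: less_le_trans)

lemma bounded_nbhd:
  fixes P :: "'a::real_normed_vector set"
  assumes "bounded P"
  shows "bounded (nbhd \<epsilon> P)"
proof -
  obtain R where R: "\<And>x. x \<in> P \<Longrightarrow> norm x \<le> R"
    using assms by (auto simp: bounded_iff)
  show ?thesis
    unfolding bounded_iff nbhd_def
  proof (intro exI ballI)
    fix y assume "y \<in> (\<Union>x\<in>P. ball x \<epsilon>)"
    then obtain x where "x \<in> P" "dist x y < \<epsilon>" by auto
    then show "norm y \<le> R + \<epsilon>"
      using R[of x] norm_triangle_ineq[of x "y - x"] by (simp add: dist_norm norm_minus_commute)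
  qed
qed

lemma closed_core: "closed (core \<delta> P)"
proof -
  have "- core \<delta> P = nbhd \<delta> (- P)"
    by (auto simp: core_def nbhd_def dist_commute)
  then show ?thesis using open_nbhd[of \<delta> "- P"] by (simp add: closed_def)
qed

lemma core_antimono: "\<delta> \<le> \<delta>' \<Longrightarrow> core \<delta>' P \<subseteq> core \<delta> P"
  by (auto simp: core_def intro: order_trans[OF subset_ball])

lemma bounded_fmeasurable_lborel:
  assumes "bounded A" "A \<in> sets borel"
  shows "A \<in> fmeasurable lborel"
  using assms emeasure_bounded_finite[OF assms(1)] by (simp add: fmeasurable_def)

text \<open>Continuity of measure from above, with boundedness of \<open>A 1\<close> supplying
  finiteness. It serves both collars and the balls shrinking to a point.\<close>

lemma ex_small_measure_decseq:
  fixes A :: "real \<Rightarrow> 'a::euclidean_space set"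
  assumes "\<And>n. A (1 / Suc n) \<in> sets borel" "bounded (A 1)" "\<And>s t. s \<le> t \<Longrightarrow> A s \<subseteq> A t"
    and "negligible (\<Inter>n. A (1 / Suc n))" "0 < r"
  shows "\<exists>\<epsilon>>0. measure lborel (A \<epsilon>) < r"
proof -
  have "(\<lambda>n. measure lborel (A (1 / Suc n))) \<longlonglongrightarrow> measure lborel (\<Inter>n. A (1 / Suc n))"
  proof (rule Lim_measure_decseq)
    show "range (\<lambda>n. A (1 / Suc n)) \<subseteq> sets lborel" using assms(1) by auto
    show "decseq (\<lambda>n. A (1 / Suc n))"
      using assms(3) by (intro decseq_SucI) (simp add: field_simps)
    fix n
    have "A (1 / Suc n) \<subseteq> A 1" by (intro assms(3)) simp
    then have "bounded (A (1 / Suc n))" using assms(2) bounded_subset by blast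
    then show "emeasure lborel (A (1 / Suc n)) \<noteq> \<infinity>" using emeasure_bounded_finite by force
  qed
  moreover have "measure lborel (\<Inter>n. A (1 / Suc n)) = 0"
  proof -
    have "(\<Inter>n. A (1 / Suc n)) \<in> sets borel" using assms(1) by auto
    moreover have "measure lebesgue (\<Inter>n. A (1 / Suc n)) = 0"
      using assms(4) by (simp add: negligible_iff_null_sets null_sets_def measure_def)
    ultimately show ?thesis by (simp add: measure_completion)
  qed
  ultimately have "eventually (\<lambda>n. measure lborel (A (1 / Suc n)) < r) sequentially"
    using assms(5) by (intro order_tendstoD(2)) auto
  then obtain n where "measure lborel (A (1 / Suc n)) < r"
    by (auto simp: eventually_sequentially)
  then show ?thesis by (intro exI[of _ "1 / Suc n"]) auto
qed

text \<open>The collars shrink to the empty set, since each point of an open set has a ball around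
  it inside the set.\<close>

lemma ex_thin_inner_collar:
  fixes P :: "'a::euclidean_space set"
  assumes "open P" "bounded P" "0 < r"
  shows "\<exists>\<delta>>0. measure lborel (P - core \<delta> P) < r"
proof (rule ex_small_measure_decseq)
  show "P - core (1 / Suc n) P \<in> sets borel" for n
    using assms(1) by (intro sets.Diff borel_open borel_closed closed_core)
  show "bounded (P - core 1 P)" using assms(2) by (rule bounded_diff)
  show "P - core s P \<subseteq> P - core t P" if "s \<le> t" for s t
    using core_antimono[OF that] by blast
  have "(\<Inter>n. P - core (1 / Suc n) P) = {}"
  proof (rule ccontr)
    assume "(\<Inter>n. P - core (1 / Suc n) P) \<noteq> {}"
    then obtain x where x: "x \<in> P" "\<And>n. x \<notin> core (1 / Suc n) P" by auto
    obtain e where "e > 0" "ball x e \<subseteq> P" using assms(1) x(1) by (auto simp: open_contains_ball)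
    moreover obtain n where "1 / Suc n < e" using nat_approx_posE[OF \<open>e > 0\<close>] .
    ultimately have "ball x (1 / Suc n) \<subseteq> P" by (auto intro: order_trans[OF subset_ball])
    then show False using x(2) by (auto simp: core_def)
  qed
  then show "negligible (\<Inter>n. P - core (1 / Suc n) P)" by simp
qed fact

text \<open>The collars shrink into the frontier; this is where its being null enters.\<close>

lemma ex_thin_outer_collar:
  fixes P :: "'a::euclidean_space set"
  assumes "open P" "bounded P" "negligible (frontier P)" "0 < r"
  shows "\<exists>\<epsilon>>0. measure lborel (nbhd \<epsilon> P - P) < r"
proof (rule ex_small_measure_decseq)
  show "nbhd (1 / Suc n) P - P \<in> sets borel" for n
    using assms(1) by (intro sets.Diff borel_open open_nbhd)
  show "bounded (nbhd 1 P - P)" using bounded_nbhd[OF assms(2)] by (rule bounded_diff)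
  show "nbhd s P - P \<subseteq> nbhd t P - P" if "s \<le> t" for s t
    using nbhd_mono[OF that] by blast
  have "(\<Inter>n. nbhd (1 / Suc n) P - P) \<subseteq> frontier P"
  proof
    fix x assume x: "x \<in> (\<Inter>n. nbhd (1 / Suc n) P - P)"
    have "\<exists>y\<in>P. dist y x < e" if "e > 0" for e
    proof -
      obtain n where "1 / Suc n < e" using nat_approx_posE[OF \<open>e > 0\<close>] .
      moreover have "x \<in> nbhd (1 / Suc n) P" using x by blast
      ultimately show ?thesis unfolding nbhd_def by (meson UN_E less_trans mem_ball)
    qed
    then have "x \<in> closure P" by (simp add: closure_approachable)
    then show "x \<in> frontier P" using x interior_subset by (auto simp: frontier_def)
  qed
  then show "negligible (\<Inter>n. nbhd (1 / Suc n) P - P)"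
    using assms(3) negligible_subset by blast
qed fact

text \<open>Disjoint translates of the slab are packed into a larger ball.\<close>

lemma measure_slab_le:
  fixes a :: "'a::euclidean_space"
  assumes "norm a = 1" "0 < \<delta>" "2 * real n * \<delta> \<le> 1"
  shows "real n * measure lborel {x \<in> ball 0 R. \<bar>a \<bullet> x - b\<bar> < \<delta>} \<le> measure lborel (ball (0::'a) (R + 1))"
proof -
  let ?S = "{x \<in> ball 0 R. \<bar>a \<bullet> x - b\<bar> < \<delta>}"
  \<comment> \<open>The slab has width \<open>2 * \<delta>\<close>, so translates in steps of that
    length along \<open>a\<close> are disjoint. The total shift is at most 1, which keeps them in
    the larger ball.\<close>
  define T where "T k = (+) ((2 * real k * \<delta>) *\<^sub>R a) ` ?S" for k
  have aa: "a \<bullet> a = 1" using assms(1) by (simp add: norm_eq_1)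
  have "open ?S"
  proof -
    have "?S = ball 0 R \<inter> {x. \<bar>a \<bullet> x - b\<bar> < \<delta>}" by auto
    moreover have "open {x. \<bar>a \<bullet> x - b\<bar> < \<delta>}" by (intro open_Collect_less continuous_intros)
    ultimately show ?thesis by auto
  qed
  then have oT: "open (T k)" for k
    unfolding T_def by (rule open_translation)
  have mT: "measure lborel (T k) = measure lborel ?S" for k
  proof -
    have "measure lborel (T k) = measure lebesgue (T k)"
      using oT by (simp add: measure_completion)
    also have "\<dots> = measure lebesgue ?S"
      unfolding T_def by (rule measure_translation)
    also have "\<dots> = measure lborel ?S"
      using \<open>open ?S\<close> by (simp add: measure_completion)
    finally show ?thesis .
  qed
  have sub: "T k \<subseteq> ball 0 (R + 1)" if "k < n" for k
  proof
    fix y assume "y \<in> T k"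
    then obtain x where x: "norm x < R" "y = (2 * real k * \<delta>) *\<^sub>R a + x" by (auto simp: T_def)
    have "norm y \<le> 2 * real k * \<delta> + norm x"
      unfolding x(2) using norm_triangle_ineq[of "(2 * real k * \<delta>) *\<^sub>R a" x] assms by simp
    moreover have "2 * real k * \<delta> \<le> 2 * real n * \<delta>" using that assms by simp
    ultimately show "y \<in> ball 0 (R + 1)" using x(1) assms(3) by simp
  qed
  have disj: "disjoint_family_on T {..<n}"
  proof -
    have slab: "\<bar>a \<bullet> y - b - 2 * real k * \<delta>\<bar> < \<delta>" if "y \<in> T k" for y k
      using that by (auto simp: T_def inner_add_right aa)
    have "T j \<inter> T k = {}" if "j < k" for j k
    proof (rule ccontr)
      assume "T j \<inter> T k \<noteq> {}"
      then obtain y where "y \<in> T j" "y \<in> T k" by auto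
      from slab[OF this(1)] slab[OF this(2)]
      have "2 * real k * \<delta> - 2 * real j * \<delta> < 2 * \<delta>" by linarith
      then have "(real k - real j - 1) * \<delta> < 0" by (simp add: algebra_simps)
      moreover have "0 \<le> (real k - real j - 1) * \<delta>"
        using that assms(2) by (intro mult_nonneg_nonneg) auto
      ultimately show False by linarith
    qed
    then show ?thesis unfolding disjoint_family_on_def by (metis Int_commute linorder_neqE_nat)
  qed
  have fin: "emeasure lborel (T k) \<noteq> \<infinity>" if "k < n" for k
  proof -
    have "bounded (T k)" using sub[OF that] bounded_subset bounded_ball by blast
    then show ?thesis using emeasure_bounded_finite by force
  qed
  have "real n * measure lborel ?S = (\<Sum>k<n. measure lborel (T k))"
    by (simp add: mT)
  also have "\<dots> = measure lborel (\<Union>k<n. T k)"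
    using disj fin oT by (intro measure_finite_Union[symmetric]) auto
  also have "\<dots> \<le> measure lborel (ball (0::'a) (R + 1))"
    using sub oT by (intro measure_mono_fmeasurable bounded_fmeasurable_lborel) auto
  finally show ?thesis .
qed

subsection \<open>Hyperplanes\<close>

lemma separating_unit_hyperplane:
  fixes C D :: "'a::euclidean_space set"
  assumes "convex C" "convex D" "C \<noteq> {}" "D \<noteq> {}" "C \<inter> D = {}"
  obtains a b where "norm a = 1" "\<And>x. x \<in> C \<Longrightarrow> a \<bullet> x \<le> b" "\<And>x. x \<in> D \<Longrightarrow> b \<le> a \<bullet> x"
proof -
  obtain a b where ab: "a \<noteq> 0" "\<forall>x\<in>C. a \<bullet> x \<le> b" "\<forall>x\<in>D. b \<le> a \<bullet> x"
    using separating_hyperplane_sets[OF assms] by blast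
  show thesis
  proof (rule that[of "a /\<^sub>R norm a" "b / norm a"])
    show "norm (a /\<^sub>R norm a) = 1" using ab(1) by simp
  qed (use ab in \<open>auto simp: divide_inverse mult.commute intro!: mult_left_mono\<close>)
qed

text \<open>If \<open>x\<close> were outside \<open>C\<close>, a hyperplane through \<open>x\<close> would leave a ball near \<open>x\<close> that misses \<open>C\<close>.\<close>

lemma mem_convex_of_meets_balls:
  fixes C :: "'a::euclidean_space set"
  assumes "convex C" and meets: "\<And>y. dist x y \<le> 3 * \<epsilon> \<Longrightarrow> C \<inter> ball y (2 * \<epsilon>) \<noteq> {}" and "0 < \<epsilon>"
  shows "x \<in> C"
proof (rule ccontr)
  assume "x \<notin> C"
  moreover have "C \<noteq> {}" using meets[of x] \<open>0 < \<epsilon>\<close> by auto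
  ultimately obtain u c where u: "norm u = 1" "u \<bullet> x \<le> c" "\<And>z. z \<in> C \<Longrightarrow> c \<le> u \<bullet> z"
    using separating_unit_hyperplane[of "{x}" C] assms(1) by auto
  \<comment> \<open>\<open>y\<close> lies \<open>3 * \<epsilon>\<close> behind the hyperplane
    through \<open>x\<close>, so the ball of radius \<open>2 * \<epsilon>\<close> around it stays
    strictly on the side away from \<open>C\<close>.\<close>
  define y where "y = x - (3 * \<epsilon>) *\<^sub>R u"
  have "dist x y \<le> 3 * \<epsilon>" using u(1) \<open>0 < \<epsilon>\<close> by (simp add: y_def dist_norm)
  then obtain z where z: "z \<in> C" "dist y z < 2 * \<epsilon>" using meets by force
  have "u \<bullet> (z - y) \<le> norm u * norm (z - y)" by (rule norm_cauchy_schwarz)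
  then have "u \<bullet> z < u \<bullet> y + 2 * \<epsilon>"
    using z(2) u(1) by (simp add: inner_diff_right dist_norm norm_minus_commute)
  also have "u \<bullet> y = u \<bullet> x - 3 * \<epsilon>"
    using u(1) by (simp add: y_def inner_diff_right norm_eq_1)
  finally show False using u(2) u(3)[OF z(1)] \<open>0 < \<epsilon>\<close> by linarith
qed

text \<open>The balls that test membership have centres within \<open>3 * \<epsilon>\<close> of
  \<open>x\<close> and radius \<open>2 * \<epsilon>\<close>, so they stay within
  \<open>5 * \<epsilon>\<close> of \<open>x\<close>. At depth \<open>6 * \<epsilon>\<close> behind
  the hyperplane they miss \<open>D\<close>, and whatever they meet is in \<open>C\<close>.\<close>

lemma mem_convex_side:
  fixes C D :: "'a::euclidean_space set"
  assumes "convex C" "0 < \<epsilon>" "norm a = 1"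
    and D: "\<And>z. z \<in> D \<Longrightarrow> b \<le> a \<bullet> z"
    and meets: "\<And>y. ball y \<epsilon> \<subseteq> P \<Longrightarrow> (C \<union> D) \<inter> ball y (2 * \<epsilon>) \<noteq> {}"
    and x: "x \<in> core (6 * \<epsilon>) P" "a \<bullet> x \<le> b - 6 * \<epsilon>"
  shows "x \<in> C"
proof (rule mem_convex_of_meets_balls[OF assms(1) _ assms(2)])
  fix y assume y: "dist x y \<le> 3 * \<epsilon>"
  have "ball y \<epsilon> \<subseteq> ball x (6 * \<epsilon>)"
  proof
    fix z assume "z \<in> ball y \<epsilon>"
    then show "z \<in> ball x (6 * \<epsilon>)" using y dist_triangle[of x z y] assms(2) by simp
  qed
  then have "ball y \<epsilon> \<subseteq> P" using x(1) by (auto simp: core_def)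
  then obtain z where "z \<in> (C \<union> D) \<inter> ball y (2 * \<epsilon>)"
    using meets[of y] by blast
  then have z: "z \<in> C \<union> D" "dist y z < 2 * \<epsilon>" by auto
  have "a \<bullet> (z - x) \<le> norm a * norm (z - x)" by (rule norm_cauchy_schwarz)
  moreover have "dist x z < 5 * \<epsilon>" using y z(2) dist_triangle[of x z y] by simp
  ultimately have "a \<bullet> z < b"
    using x(2) assms(2,3) by (simp add: inner_diff_right dist_norm norm_minus_commute)
  then have "z \<in> C" using z(1) D by force
  then show "C \<inter> ball y (2 * \<epsilon>) \<noteq> {}" using z(2) by auto
qed

lemma core_diff_subset_slab:
  fixes C D :: "'a::euclidean_space set"
  assumes "convex C" "convex D" "0 < \<epsilon>" "norm a = 1"
    and C: "\<And>z. z \<in> C \<Longrightarrow> a \<bullet> z \<le> b" and D: "\<And>z. z \<in> D \<Longrightarrow> b \<le> a \<bullet> z"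
    and meets: "\<And>y. ball y \<epsilon> \<subseteq> P \<Longrightarrow> (C \<union> D) \<inter> ball y (2 * \<epsilon>) \<noteq> {}"
  shows "core (6 * \<epsilon>) P - (C \<union> D) \<subseteq> {x. \<bar>a \<bullet> x - b\<bar> < 6 * \<epsilon>}"
proof
  fix x assume x: "x \<in> core (6 * \<epsilon>) P - (C \<union> D)"
  have "\<not> a \<bullet> x \<le> b - 6 * \<epsilon>"
    using mem_convex_side[OF assms(1,3,4) D meets] x by blast
  \<comment> \<open>The opposite side, by exchanging \<open>C\<close> with \<open>D\<close> and
    reversing the normal.\<close>
  moreover have "\<not> (- a) \<bullet> x \<le> - b - 6 * \<epsilon>"
    using mem_convex_side[of D \<epsilon> "- a" C "- b" P x] assms(2,3,4) C meets x by (auto simp: Un_commute)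
  ultimately show "x \<in> {x. \<bar>a \<bullet> x - b\<bar> < 6 * \<epsilon>}" by auto
qed

subsection \<open>Closeness in the Wasserstein metric forces closeness in volume\<close>

text \<open>A single convex region is treated as two pieces with \<open>D\<close> empty, so that one
  argument covers both kinds of region.\<close>

lemma region_space_cases:
  assumes "Q \<in> region_space"
  obtains C D where "Q = C \<union> D" "convex C" "convex D" "C \<inter> D = {}" "C \<noteq> {}"
proof -
  consider "Q \<in> convex_regions" | "Q \<in> two_convex_regions"
    using assms by (auto simp: region_space_def)
  then show thesis
  proof cases
    case 1
    then show thesis using that[of Q "{}"] by (auto simp: convex_regions_def region_def)
  next
    case 2
    then obtain X Y where "Q = X \<union> Y" and X: "X \<in> convex_regions" and Y: "Y \<in> convex_regions"
      and d: "region_dist X Y > 0"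
      by (auto simp: two_convex_regions_def)
    moreover have "X \<inter> Y = {}"
    proof (rule ccontr)
      assume "X \<inter> Y \<noteq> {}"
      then obtain x where "x \<in> closure X" "x \<in> closure Y" using closure_subset by blast
      then have "region_dist X Y \<le> dist x x" unfolding region_dist_def by (rule setdist_le_dist)
      then show False using d by simp
    qed
    ultimately show thesis using that[of X Y] by (auto simp: convex_regions_def region_def)
  qed
qed

lemma region_space_bounded_open:
  assumes "Q \<in> region_space"
  shows "bounded_open Q"
  using assms unfolding region_space_def two_convex_regions_def convex_regions_def region_def
  by unfold_locales auto

lemma region_space_negligible_frontier:
  assumes "Q \<in> region_space"
  shows "negligible (frontier Q)"
proof -
  obtain C D where "Q = C \<union> D" "convex C" "convex D"
    using region_space_cases[OF assms] .
  moreover have "negligible (frontier C \<union> frontier D)"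
    using calculation by (intro negligible_Un negligible_convex_frontier)
  ultimately show ?thesis
    using frontier_Un_subset[of C D] negligible_subset by blast
qed

text \<open>Markov's inequality for the cost at the threshold
  \<open>\<psi> \<epsilon>\<close>.\<close>

lemma transport_map_moving_little:
  fixes P Q :: "'a::euclidean_space set"
  assumes \<psi>: "mulholland \<psi>" and "bounded_open P" "bounded_open Q"
    and W: "wasserstein \<psi> P Q < \<epsilon> / real k" and "0 < \<epsilon>" "0 < k"
  obtains \<gamma> where "\<gamma> \<in> borel_measurable borel"
    and "distr (uniform_measure lborel P) borel \<gamma> = uniform_measure lborel Q"
    and "AE x in uniform_measure lborel P. \<gamma> x \<in> Q"
    and "measure (uniform_measure lborel P) {x. \<epsilon> \<le> dist x (\<gamma> x)} < 1 / real k"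
proof -
  interpret P: bounded_open P by fact
  obtain \<gamma> where [measurable]: "\<gamma> \<in> borel_measurable borel" and \<gamma>: "distr P.U borel \<gamma> = uniform_measure lborel Q"
      "AE x in P.U. \<gamma> x \<in> Q" "integrable P.U (\<lambda>x. \<psi> (dist x (\<gamma> x)))"
      "P.expectation (\<lambda>x. \<psi> (dist x (\<gamma> x))) < \<psi> \<epsilon> / real k"
    using cheap_transport_map[OF assms] .
  have pos: "0 < \<psi> \<epsilon>" using mulholland_pos[OF \<psi> \<open>0 < \<epsilon>\<close>] .
  have [measurable]: "(\<lambda>x. \<psi> (dist x (\<gamma> x))) \<in> borel_measurable borel"
    by (intro mulholland_borel_measurable[OF \<psi>]) auto
  have "P.prob {x. \<epsilon> \<le> dist x (\<gamma> x)} \<le> P.prob {x\<in>space P.U. \<psi> \<epsilon> \<le> \<psi> (dist x (\<gamma> x))}"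
    using \<open>0 < \<epsilon>\<close> mulholland_mono[OF \<psi>] by (intro P.finite_measure_mono) auto
  also have "\<dots> \<le> P.expectation (\<lambda>x. \<psi> (dist x (\<gamma> x))) / \<psi> \<epsilon>"
    using pos \<gamma>(3) by (intro integral_Markov_inequality_measure[where A="{}"]) (auto simp: mulholland_nonneg[OF \<psi>])
  also have "\<dots> < 1 / real k"
    using \<gamma>(4) pos \<open>0 < k\<close> by (simp add: field_simps)
  finally show thesis
    by (intro that[OF _ \<gamma>(1,2)]) auto
qed

text \<open>If \<open>Q\<close> missed the larger ball, all mass in the concentric ball of radius
  \<open>\<epsilon>\<close> would have to move by at least \<open>\<epsilon>\<close>. That mass is
  at least \<open>1 / k\<close> by the choice of \<open>k\<close>, too much for the transport
  map.\<close>

lemma meets_ball_of_wasserstein_less: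
  fixes P Q :: "'a::euclidean_space set"
  assumes \<psi>: "mulholland \<psi>" and "bounded_open P" "bounded_open Q"
    and W: "wasserstein \<psi> P Q < \<epsilon> / real k" and "0 < \<epsilon>" "0 < k"
    and y: "ball y \<epsilon> \<subseteq> P" and k: "measure lborel P \<le> real k * measure lborel (ball (0::'a) \<epsilon>)"
  shows "Q \<inter> ball y (2 * \<epsilon>) \<noteq> {}"
proof
  assume empty: "Q \<inter> ball y (2 * \<epsilon>) = {}"
  interpret P: bounded_open P by fact
  obtain \<gamma> where [measurable]: "\<gamma> \<in> borel_measurable borel"
    and \<gamma>: "AE x in P.U. \<gamma> x \<in> Q" "P.prob {x. \<epsilon> \<le> dist x (\<gamma> x)} < 1 / real k"
    using transport_map_moving_little[OF assms(1-6)] .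
  have "P.prob (ball y \<epsilon>) \<le> P.prob {x. \<epsilon> \<le> dist x (\<gamma> x)}"
  proof (rule P.finite_measure_mono_AE)
    show "AE x in P.U. x \<in> ball y \<epsilon> \<longrightarrow> x \<in> {x. \<epsilon> \<le> dist x (\<gamma> x)}"
      using \<gamma>(1)
    proof eventually_elim
      case (elim x)
      then have "2 * \<epsilon> \<le> dist y (\<gamma> x)" using empty by auto
      then show ?case using dist_triangle[of y "\<gamma> x" x] by auto
    qed
  qed auto
  moreover have "P.prob (ball y \<epsilon>) = measure lborel (ball (0::'a) \<epsilon>) / P.vol"
    using y content_ball[of \<epsilon> y] content_ball[of \<epsilon> "0::'a"] \<open>0 < \<epsilon>\<close>
    by (simp add: P.prob_eq Int_absorb1)
  ultimately have "measure lborel (ball (0::'a) \<epsilon>) / P.vol < 1 / real k"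
    using \<gamma>(2) by linarith
  then show False
    using k P.vol_pos \<open>0 < k\<close> by (simp add: field_simps)
qed

text \<open>Mass arriving outside the \<open>\<epsilon>\<close>-neighbourhood of \<open>P\<close>
  has moved by at least \<open>\<epsilon>\<close>, so it is less than a fraction
  \<open>1 / k\<close> of \<open>Q\<close>. The bound has to be free of the volume of
  \<open>Q\<close>, which is not controlled in advance.\<close>

lemma measure_diff_le_of_wasserstein_less:
  fixes P Q :: "'a::euclidean_space set"
  assumes \<psi>: "mulholland \<psi>" and "bounded_open P" "bounded_open Q"
    and W: "wasserstein \<psi> P Q < \<epsilon> / real k" and "0 < \<epsilon>" "\<epsilon> \<le> 1" "2 \<le> k"
  shows "measure lborel (Q - P) \<le> measure lborel (nbhd \<epsilon> P - P) + 2 * measure lborel (nbhd 1 P) / real k"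
proof -
  interpret P: bounded_open P by fact
  interpret Q: bounded_open Q by fact
  obtain \<gamma> where [measurable]: "\<gamma> \<in> borel_measurable borel"
    and distr: "distr P.U borel \<gamma> = Q.U" and \<gamma>: "P.prob {x. \<epsilon> \<le> dist x (\<gamma> x)} < 1 / real k"
    using transport_map_moving_little[OF assms(1-5)] \<open>2 \<le> k\<close> by (metis not_numeral_le_zero not_gr_zero)
  have [measurable, simp]: "nbhd \<delta> P \<in> sets borel" for \<delta> by (intro borel_open open_nbhd)
  have fin: "A \<in> fmeasurable lborel" if "A \<subseteq> Q \<union> nbhd 1 P" "A \<in> sets borel" for A
  proof -
    have "bounded A"
      using that bounded_nbhd[OF P.bounded_P] Q.bounded_P by (meson bounded_Un bounded_subset)
    then show ?thesis using that(2) by (rule bounded_fmeasurable_lborel)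
  qed
  have n1: "nbhd \<epsilon> P \<subseteq> nbhd 1 P" using \<open>\<epsilon> \<le> 1\<close> by (rule nbhd_mono)
  have "Q.prob (- nbhd \<epsilon> P) = P.prob (\<gamma> -` (- nbhd \<epsilon> P))"
    unfolding distr[symmetric] by (subst measure_distr) auto
  also have "\<dots> \<le> P.prob {x. \<epsilon> \<le> dist x (\<gamma> x)}"
  proof (rule P.finite_measure_mono_AE)
    show "AE x in P.U. x \<in> \<gamma> -` (- nbhd \<epsilon> P) \<longrightarrow> x \<in> {x. \<epsilon> \<le> dist x (\<gamma> x)}"
      using P.AE_mem by eventually_elim (auto simp: nbhd_def not_less)
  qed auto
  also note \<gamma>
  finally have "measure lborel (Q \<inter> - nbhd \<epsilon> P) / Q.vol < 1 / real k"
    by (subst (asm) Q.prob_eq) auto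
  then have far: "measure lborel (Q - nbhd \<epsilon> P) \<le> Q.vol / real k"
    using Q.vol_pos \<open>2 \<le> k\<close> by (simp add: field_simps Diff_eq)
  \<comment> \<open>Because \<open>k\<close> is at least 2, at most half of \<open>Q\<close> is far
    from \<open>P\<close>. That half is absorbed on the left, which bounds the volume of
    \<open>Q\<close> in terms of \<open>P\<close> alone.\<close>
  have "Q.vol \<le> measure lborel (nbhd 1 P \<union> (Q - nbhd \<epsilon> P))"
    using n1 by (intro measure_mono_fmeasurable fin) auto
  also have "\<dots> \<le> measure lborel (nbhd 1 P) + measure lborel (Q - nbhd \<epsilon> P)"
    by (intro measure_Un_le) auto
  also have "\<dots> \<le> measure lborel (nbhd 1 P) + Q.vol / 2"
  proof -
    have "Q.vol / real k \<le> Q.vol / 2" using Q.vol_pos \<open>2 \<le> k\<close> by (intro divide_left_mono) auto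
    then show ?thesis using far by linarith
  qed
  finally have "Q.vol \<le> 2 * measure lborel (nbhd 1 P)" by simp
  then have "Q.vol / real k \<le> 2 * measure lborel (nbhd 1 P) / real k"
    by (intro divide_right_mono) auto
  moreover have "measure lborel (Q - P) \<le> measure lborel ((nbhd \<epsilon> P - P) \<union> (Q - nbhd \<epsilon> P))"
    using n1 by (intro measure_mono_fmeasurable fin) auto
  moreover have "measure lborel ((nbhd \<epsilon> P - P) \<union> (Q - nbhd \<epsilon> P))
      \<le> measure lborel (nbhd \<epsilon> P - P) + measure lborel (Q - nbhd \<epsilon> P)"
    by (intro measure_Un_le) auto
  ultimately show ?thesis using far by linarith
qed

text \<open>The error \<open>r\<close> is split into quarters: inner collar and slab for
  \<open>P - Q\<close>, outer collar and far mass for \<open>Q - P\<close>. All constants are fixed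
  before \<open>Q\<close>; the slab estimate is uniform over all hyperplanes.\<close>

lemma ex_wasserstein_radius:
  fixes P :: "'a::euclidean_space set"
  assumes \<psi>: "mulholland \<psi>" and P: "P \<in> region_space" and "0 < r"
  shows "\<exists>s>0. \<forall>Q\<in>region_space. wasserstein \<psi> P Q < s \<longrightarrow> symdiff_dist P Q < r"
proof -
  interpret P: bounded_open P using P by (rule region_space_bounded_open)
  obtain R where R: "P \<subseteq> ball 0 R"
    using P.bounded_P bounded_subset_ballD by blast
  let ?B = "measure lborel (ball (0::'a) (R + 1))"
  obtain \<delta>1 where \<delta>1: "0 < \<delta>1" "measure lborel (P - core \<delta>1 P) < r / 4"
    using ex_thin_inner_collar[OF P.open_P P.bounded_P, of "r / 4"] \<open>0 < r\<close> by auto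
  obtain \<epsilon>1 where \<epsilon>1: "0 < \<epsilon>1" "measure lborel (nbhd \<epsilon>1 P - P) < r / 4"
    using ex_thin_outer_collar[OF P.open_P P.bounded_P region_space_negligible_frontier[OF P], of "r / 4"] \<open>0 < r\<close>
    by auto
  obtain n :: nat where n: "0 < n" "?B < real n * (r / 4)"
    using reals_Archimedean3[of "r / 4"] \<open>0 < r\<close>
    by (metis divide_pos_pos gr0I measure_nonneg mult_zero_left not_le of_nat_0 zero_less_numeral)
  \<comment> \<open>The three bounds put \<open>core \<delta>1 P\<close> inside
    \<open>core (6 * \<epsilon>) P\<close>, keep the neighbourhood inside the outer collar, and let
    \<open>n\<close> slabs of half-width \<open>6 * \<epsilon>\<close> be packed.\<close>
  define \<epsilon> where "\<epsilon> = min (\<delta>1 / 6) (min \<epsilon>1 (1 / (12 * real n)))"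
  have "1 / (12 * real n) \<le> 1" using n(1) by (simp add: field_simps)
  then have \<epsilon>: "0 < \<epsilon>" "6 * \<epsilon> \<le> \<delta>1" "\<epsilon> \<le> \<epsilon>1" "\<epsilon> \<le> 1" "\<epsilon> \<le> 1 / (12 * real n)"
    using \<delta>1(1) \<epsilon>1(1) n(1) unfolding \<epsilon>_def by (simp_all add: min_le_iff_disj)
  have n\<epsilon>: "2 * real n * (6 * \<epsilon>) \<le> 1" using \<epsilon>(5) n by (simp add: field_simps)
  define v where "v = measure lborel (ball (0::'a) \<epsilon>)"
  have "0 < v" unfolding v_def using \<epsilon>(1) by simp
  \<comment> \<open>The three demands on \<open>k\<close> serve, in order, to control the volume of
    \<open>Q\<close>, to make \<open>Q\<close> meet every test ball, and to push the far mass below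
    \<open>r / 4\<close>.\<close>
  obtain k :: nat where k: "2 \<le> k" "P.vol / v \<le> real k" "8 * measure lborel (nbhd 1 P) / r < real k"
  proof -
    define m where "m = Max {2, P.vol / v, 8 * measure lborel (nbhd 1 P) / r}"
    obtain k :: nat where "m < real k" using reals_Archimedean2 by blast
    then show thesis using that[of k] by (auto simp: m_def)
  qed
  have "symdiff_dist P Q < r" if Q: "Q \<in> region_space" and W: "wasserstein \<psi> P Q < \<epsilon> / real k" for Q
  proof -
    interpret Q: bounded_open Q using Q by (rule region_space_bounded_open)
    note less = \<psi> P.bounded_open_axioms Q.bounded_open_axioms W \<epsilon>(1)
    have meets: "Q \<inter> ball y (2 * \<epsilon>) \<noteq> {}" if "ball y \<epsilon> \<subseteq> P" for y
      using meets_ball_of_wasserstein_less[OF less _ that] k \<open>0 < v\<close> by (simp add: v_def field_simps)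
    obtain C D where CD: "Q = C \<union> D" "convex C" "convex D" "C \<inter> D = {}" "C \<noteq> {}"
      using region_space_cases[OF Q] .
    obtain a b where ab: "norm a = 1" "\<And>x. x \<in> C \<Longrightarrow> a \<bullet> x \<le> b" "\<And>x. x \<in> D \<Longrightarrow> b \<le> a \<bullet> x"
    proof (cases "D = {}")
      case True
      \<comment> \<open>With a single piece any hyperplane with \<open>Q\<close> on one side will
        do, so any unit normal and a norm bound of \<open>Q\<close> serve.\<close>
      obtain S where "\<And>x. x \<in> Q \<Longrightarrow> norm x \<le> S" using Q.bounded_P by (auto simp: bounded_iff)
      moreover obtain a :: 'a where "norm a = 1" using vector_choose_size[of 1] by auto
      moreover have "a \<bullet> x \<le> norm x" if "norm a = 1" for a x :: 'a
        using norm_cauchy_schwarz[of a x] that by simp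
      ultimately show thesis using that[of a S] True CD(1) by (fastforce intro: order_trans)
    next
      case False
      then show thesis using separating_unit_hyperplane[of C D] CD that by blast
    qed
    let ?S = "{x \<in> ball 0 R. \<bar>a \<bullet> x - b\<bar> < 6 * \<epsilon>}"
    have "core (6 * \<epsilon>) P - Q \<subseteq> {x. \<bar>a \<bullet> x - b\<bar> < 6 * \<epsilon>}"
      unfolding CD(1) using CD(2,3) \<epsilon>(1) ab meets[unfolded CD(1)] by (rule core_diff_subset_slab)
    then have "P - Q \<subseteq> (P - core \<delta>1 P) \<union> ?S"
      using R core_antimono[OF \<epsilon>(2), of P] by blast
    moreover have S: "?S \<in> sets borel"
    proof -
      have "?S = ball 0 R \<inter> {x. \<bar>a \<bullet> x - b\<bar> < 6 * \<epsilon>}" by auto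
      moreover have "open {x. \<bar>a \<bullet> x - b\<bar> < 6 * \<epsilon>}" by (intro open_Collect_less continuous_intros)
      ultimately show ?thesis by auto
    qed
    moreover have core: "P - core \<delta>1 P \<in> sets borel"
      by (intro sets.Diff P.sets_P borel_closed closed_core)
    moreover have "bounded ((P - core \<delta>1 P) \<union> ?S)"
      by (rule bounded_subset[OF bounded_ball[of 0 R]]) (use R in auto)
    ultimately have "measure lborel (P - Q) \<le> measure lborel ((P - core \<delta>1 P) \<union> ?S)"
      by (intro measure_mono_fmeasurable bounded_fmeasurable_lborel sets.Un) auto
    also have "\<dots> \<le> measure lborel (P - core \<delta>1 P) + measure lborel ?S"
      using S core by (intro measure_Un_le) auto
    also have "measure lborel ?S < r / 4"
    proof -
      have "real n * measure lborel ?S < real n * (r / 4)"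
        using measure_slab_le[OF ab(1) _ n\<epsilon>, of R b] \<epsilon>(1) n(2) by linarith
      then show ?thesis using n(1) by (simp only: mult_less_cancel_left_pos of_nat_0_less_iff)
    qed
    finally have inner: "measure lborel (P - Q) < r / 2" using \<delta>1(2) by linarith
    have "measure lborel (nbhd \<epsilon> P - P) \<le> measure lborel (nbhd \<epsilon>1 P - P)"
      using nbhd_mono[OF \<epsilon>(3), of P]
      by (intro measure_mono_fmeasurable bounded_fmeasurable_lborel bounded_diff bounded_nbhd P.bounded_P
          sets.Diff borel_open open_nbhd P.open_P) (auto intro: borel_open open_nbhd)
    moreover have "2 * measure lborel (nbhd 1 P) / real k < r / 4"
      using k(1,3) \<open>0 < r\<close> by (simp add: field_simps)
    ultimately have "measure lborel (Q - P) < r / 2"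
      using measure_diff_le_of_wasserstein_less[OF less \<epsilon>(4) k(1)] \<epsilon>1(2) by linarith
    moreover have "symdiff_dist P Q \<le> measure lborel (P - Q) + measure lborel (Q - P)"
      unfolding symdiff_dist_def by (intro measure_Un_le) auto
    ultimately show ?thesis using inner by linarith
  qed
  then show ?thesis using \<epsilon>(1) k(1) by (intro exI[of _ "\<epsilon> / real k"]) auto
qed

subsection \<open>Far-away pieces of small volume\<close>

text \<open>Compares the centres of mass in direction \<open>e\<close>. By linear growth the mean
  displacement is at most \<open>\<epsilon>\<close> plus
  \<open>\<epsilon> / \<psi> \<epsilon>\<close> times the mean cost, and that second term is below
  \<open>\<epsilon>\<close>.\<close>

lemma expectation_inner_close:
  fixes P Q :: "'a::euclidean_space set"
  assumes \<psi>: "mulholland \<psi>" and "bounded_open P" "bounded_open Q"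
    and W: "wasserstein \<psi> P Q < \<epsilon>" and "0 < \<epsilon>" and "norm e = 1"
  shows "(LINT x|uniform_measure lborel Q. x \<bullet> e) < (LINT x|uniform_measure lborel P. x \<bullet> e) + 2 * \<epsilon>"
proof -
  interpret P: bounded_open P by fact
  interpret Q: bounded_open Q by fact
  obtain \<gamma> where [measurable]: "\<gamma> \<in> borel_measurable borel" and distr: "distr P.U borel \<gamma> = Q.U"
    and AE: "AE x in P.U. \<gamma> x \<in> Q" and int: "integrable P.U (\<lambda>x. \<psi> (dist x (\<gamma> x)))"
    and less: "P.expectation (\<lambda>x. \<psi> (dist x (\<gamma> x))) < \<psi> \<epsilon> / real 1"
    using cheap_transport_map[OF assms(1-3), of \<epsilon> 1] W \<open>0 < \<epsilon>\<close> by auto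
  have pos: "0 < \<psi> \<epsilon>" using mulholland_pos[OF \<psi> \<open>0 < \<epsilon>\<close>] .
  have inner_le: "\<bar>x \<bullet> e\<bar> \<le> norm x" for x
    using Cauchy_Schwarz_ineq2[of x e] \<open>norm e = 1\<close> by simp
  obtain BP BQ where B: "\<And>x. x \<in> P \<Longrightarrow> norm x \<le> BP" "\<And>x. x \<in> Q \<Longrightarrow> norm x \<le> BQ"
    using P.bounded_P Q.bounded_P by (auto simp: bounded_iff)
  have intP: "integrable P.U (\<lambda>x. x \<bullet> e)"
    using P.AE_mem
    by (intro P.integrable_bounded[of _ BP]) (auto elim!: eventually_mono intro: order_trans[OF inner_le] B)
  have intQ: "integrable P.U (\<lambda>x. \<gamma> x \<bullet> e)"
    using AE
    by (intro P.integrable_bounded[of _ BQ]) (auto elim!: eventually_mono intro: order_trans[OF inner_le] B)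
  have "Q.expectation (\<lambda>x. x \<bullet> e) = P.expectation (\<lambda>x. \<gamma> x \<bullet> e)"
    unfolding distr[symmetric] by (rule integral_distr) auto
  also have "\<dots> \<le> P.expectation (\<lambda>x. x \<bullet> e + (\<epsilon> + \<epsilon> / \<psi> \<epsilon> * \<psi> (dist x (\<gamma> x))))"
  proof (rule integral_mono)
    fix x
    have "\<gamma> x \<bullet> e - x \<bullet> e \<le> dist x (\<gamma> x)"
      using inner_le[of "\<gamma> x - x"] by (simp add: inner_diff_left dist_norm norm_minus_commute)
    also have "\<dots> \<le> \<epsilon> + \<epsilon> * (\<psi> (dist x (\<gamma> x)) / \<psi> \<epsilon>)"
      using \<psi> \<open>0 < \<epsilon>\<close> by (intro mulholland_linear_growth) auto
    finally show "\<gamma> x \<bullet> e \<le> x \<bullet> e + (\<epsilon> + \<epsilon> / \<psi> \<epsilon> * \<psi> (dist x (\<gamma> x)))" by simp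
  qed (use intP intQ int in auto)
  also have "\<dots> = P.expectation (\<lambda>x. x \<bullet> e) + (\<epsilon> + \<epsilon> / \<psi> \<epsilon> * P.expectation (\<lambda>x. \<psi> (dist x (\<gamma> x))))"
    using intP int P.prob_space by simp
  also have "\<epsilon> / \<psi> \<epsilon> * P.expectation (\<lambda>x. \<psi> (dist x (\<gamma> x))) < \<epsilon> / \<psi> \<epsilon> * \<psi> \<epsilon>"
    using less pos \<open>0 < \<epsilon>\<close> by (intro mult_strict_left_mono) auto
  finally show ?thesis using pos by simp
qed

lemma ball_mem_convex_regions:
  fixes c :: "'a::euclidean_space"
  assumes "0 < \<rho>"
  shows "ball c \<rho> \<in> convex_regions"
  using assms by (auto simp: convex_regions_def region_def interior_cball)

text \<open>The small ball is placed at a distance of the order of the inverse of its share of the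
  volume, so its pull on the centre of mass does not fade as \<open>\<rho>\<close> shrinks.\<close>

lemma ball_with_distant_ball:
  fixes e :: "'a::euclidean_space"
  assumes e: "norm e = 1" and \<rho>: "0 < \<rho>" "\<rho> \<le> 1"
  obtains Q where "Q \<in> region_space" "symdiff_dist (ball 0 1) Q = measure lborel (ball (0::'a) \<rho>)"
    and "2 \<le> (LINT x|uniform_measure lborel Q. x \<bullet> e)"
proof -
  let ?v1 = "measure lborel (ball (0::'a) 1)" and ?v = "measure lborel (ball (0::'a) \<rho>)"
  have v: "0 < ?v" using \<rho> by simp
  \<comment> \<open>The small ball has a share \<open>1 / q\<close> of the total volume. It
    contributes at least \<open>(t - 1) / q\<close>, which exceeds 3, and the unit ball contributes
    at least -1.\<close>
  define q where "q = (?v1 + ?v) / ?v"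
  define t where "t = 2 + 3 * q"
  have q: "q * ?v = ?v1 + ?v" unfolding q_def by (rule nonzero_eq_divide_eq[THEN iffD1, OF _ refl]) (use v in simp)
  have "1 \<le> q" using v by (simp add: q_def)
  then have t: "5 \<le> t" unfolding t_def by linarith
  define B1 B2 where "B1 = ball (0::'a) 1" and "B2 = ball (t *\<^sub>R e) \<rho>"
  define Q where "Q = B1 \<union> B2"
  have far: "3 \<le> dist x y" if "x \<in> cball 0 1" "y \<in> cball (t *\<^sub>R e) \<rho>" for x y :: 'a
  proof -
    have "dist 0 (t *\<^sub>R e) = t" using e t by simp
    moreover have "dist 0 (t *\<^sub>R e) \<le> dist 0 x + (dist x y + dist y (t *\<^sub>R e))"
      by (meson add_left_mono dist_triangle order_trans)
    ultimately show ?thesis using that t \<rho> by (simp add: dist_commute)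
  qed
  have disj: "B1 \<inter> B2 = {}"
  proof (rule ccontr)
    assume "B1 \<inter> B2 \<noteq> {}"
    then obtain x where "x \<in> B1" "x \<in> B2" by blast
    then have "x \<in> cball 0 1" "x \<in> cball (t *\<^sub>R e) \<rho>"
      by (simp_all add: B1_def B2_def)
    from far[OF this] show False by simp
  qed
  have volB2: "measure lborel B2 = ?v"
    using content_ball[of \<rho> "t *\<^sub>R e"] content_ball[of \<rho> "0::'a"] \<rho> by (simp add: B2_def)
  have "region_dist B1 B2 \<ge> 3"
    using far \<rho> unfolding region_dist_def B1_def B2_def by (intro le_setdistI) auto
  moreover have "B1 \<in> convex_regions" "B2 \<in> convex_regions"
    unfolding B1_def B2_def using \<rho> by (auto intro: ball_mem_convex_regions)
  ultimately have "\<exists>X Y. Q = X \<union> Y \<and> X \<in> convex_regions \<and> Y \<in> convex_regions \<and> region_dist X Y > 0"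
    unfolding Q_def by (intro exI[of _ B1] exI[of _ B2]) simp
  then have Q: "Q \<in> region_space"
    by (simp add: region_space_def two_convex_regions_def)
  interpret Q: bounded_open Q using Q by (rule region_space_bounded_open)
  have [measurable]: "B1 \<in> sets borel" "B2 \<in> sets borel" by (auto simp: B1_def B2_def)
  have "Q.vol \<le> ?v1 + ?v"
    unfolding Q_def volB2[symmetric] unfolding B1_def[symmetric] by (intro measure_Un_le) auto
  have int: "integrable Q.U (indicator B1 :: 'a \<Rightarrow> real)" "integrable Q.U (indicator B2 :: 'a \<Rightarrow> real)"
    by (auto intro!: Q.integrable_bounded[where B = 1] simp: indicator_def)
  have "2 \<le> (t - 1) * (?v / Q.vol) - 1"
  proof -
    have "3 * Q.vol \<le> 3 * (?v1 + ?v)" using \<open>Q.vol \<le> ?v1 + ?v\<close> by simp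
    also have "\<dots> \<le> ?v + 3 * (q * ?v)"
      unfolding q by simp
    also have "\<dots> = (t - 1) * ?v"
      by (simp add: t_def algebra_simps)
    finally show ?thesis using Q.vol_pos by (simp add: field_simps)
  qed
  also have "\<dots> \<le> (t - 1) * Q.prob B2 - Q.prob B1"
  proof -
    have "Q \<inter> B2 = B2" by (auto simp: Q_def)
    then have "Q.prob B2 = ?v / Q.vol" using Q.prob_eq[of B2] by (simp add: volB2)
    then show ?thesis using Q.prob_le_1[of B1] by simp
  qed
  also have "\<dots> = Q.expectation (\<lambda>x. (t - 1) * indicator B2 x - indicator B1 x)"
    using int by (subst Bochner_Integration.integral_diff) auto
  also have "\<dots> \<le> Q.expectation (\<lambda>x. x \<bullet> e)"
  proof (rule integral_mono_AE)
    obtain S where S: "\<And>x. x \<in> Q \<Longrightarrow> norm x \<le> S" using Q.bounded_P by (auto simp: bounded_iff)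
    have inner_le: "\<bar>x \<bullet> e\<bar> \<le> norm x" for x
      using Cauchy_Schwarz_ineq2[of x e] e by simp
    show "integrable Q.U (\<lambda>x. x \<bullet> e)"
      using Q.AE_mem
      by (intro Q.integrable_bounded[of _ S]) (auto elim!: eventually_mono intro: order_trans[OF inner_le] S)
    show "AE x in Q.U. (t - 1) * indicator B2 x - indicator B1 x \<le> x \<bullet> e"
      using Q.AE_mem
    proof eventually_elim
      case (elim x)
      then consider "x \<in> B1" "x \<notin> B2" | "x \<in> B2" "x \<notin> B1" using disj by (auto simp: Q_def)
      then show ?case
      proof cases
        case 1
        then show ?thesis using inner_le[of x] by (simp add: B1_def)
      next
        case 2
        have "e \<bullet> e = 1" using e by (simp add: norm_eq_1)
        then show ?thesis
          using 2 inner_le[of "x - t *\<^sub>R e"] \<rho>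
          by (simp add: B2_def dist_norm norm_minus_commute inner_diff_left)
      qed
    qed
  qed (use int in auto)
  finally have "2 \<le> Q.expectation (\<lambda>x. x \<bullet> e)" .
  moreover have "(ball 0 1 - Q) \<union> (Q - ball 0 1) = B2"
    using disj by (auto simp: Q_def B1_def)
  then have "symdiff_dist (ball 0 1) Q = ?v"
    unfolding symdiff_dist_def by (simp add: volB2)
  ultimately show thesis using that Q by blast
qed

section \<open>Comparison of the two topologies\<close>

theorem theorem15:
  fixes \<psi> :: "real \<Rightarrow> real"
  assumes "CARD('n::finite) \<ge> 2"
    and "mulholland \<psi>"
  shows "strictly_finer
           (dist_topology (region_space :: (real ^ 'n) set set) (wasserstein \<psi>))
           (dist_topology (region_space :: (real ^ 'n) set set) symdiff_dist)"
proof -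
  let ?M = "region_space :: (real ^ 'n) set set"
  let ?W = "dist_topology ?M (wasserstein \<psi>)" and ?V = "dist_topology ?M symdiff_dist"
  have finer: "openin ?W T" if "openin ?V T" for T
    unfolding openin_dist_topology
  proof (intro conjI ballI)
    show "T \<subseteq> ?M" using that by (simp add: openin_dist_topology)
    fix P assume "P \<in> T"
    have "\<exists>r>0. {Q \<in> ?M. symdiff_dist P Q < r} \<subseteq> T"
      using that \<open>P \<in> T\<close> unfolding openin_dist_topology by (elim conjE bspec)
    then obtain r where "0 < r" and r: "{Q \<in> ?M. symdiff_dist P Q < r} \<subseteq> T" by (elim exE conjE)
    have "P \<in> ?M" using \<open>T \<subseteq> ?M\<close> \<open>P \<in> T\<close> by (rule subsetD)
    then obtain s where "0 < s" "\<forall>Q\<in>?M. wasserstein \<psi> P Q < s \<longrightarrow> symdiff_dist P Q < r"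
      using ex_wasserstein_radius[OF assms(2) _ \<open>0 < r\<close>] by metis
    then show "\<exists>s>0. {Q \<in> ?M. wasserstein \<psi> P Q < s} \<subseteq> T"
      using r by (intro exI[of _ s]) auto
  qed
  obtain e :: "real ^ 'n" where e: "norm e = 1" using vector_choose_size[of 1] by auto
  \<comment> \<open>The separating open set: it contains the unit ball, whose centre of mass has
    coordinate at most 1, but excludes the regions obtained by adding a distant small ball.\<close>
  define T where "T = {Q \<in> ?M. (LINT x|uniform_measure lborel Q. x \<bullet> e) < 2}"
  have "openin ?W T"
    unfolding openin_dist_topology
  proof (intro conjI ballI)
    show "T \<subseteq> ?M" by (auto simp: T_def)
    fix P assume P: "P \<in> T"
    \<comment> \<open>Half the slack below 2, as the centre of mass may shift by up to
      \<open>2 * \<epsilon>\<close>.\<close>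
    define \<epsilon> where "\<epsilon> = (2 - (LINT x|uniform_measure lborel P. x \<bullet> e)) / 2"
    have "0 < \<epsilon>" using P by (simp add: T_def \<epsilon>_def)
    moreover have "Q \<in> T" if Q: "Q \<in> ?M" "wasserstein \<psi> P Q < \<epsilon>" for Q
    proof -
      have "bounded_open P" "bounded_open Q"
        using P Q by (auto simp: T_def intro: region_space_bounded_open)
      note expectation_inner_close[OF assms(2) this Q(2) \<open>0 < \<epsilon>\<close> e]
      also have "(LINT x|uniform_measure lborel P. x \<bullet> e) + 2 * \<epsilon> = 2"
        by (simp add: \<epsilon>_def field_simps)
      finally show ?thesis using Q(1) by (simp add: T_def)
    qed
    ultimately show "\<exists>s>0. {Q \<in> ?M. wasserstein \<psi> P Q < s} \<subseteq> T" by blast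
  qed
  moreover have "\<not> openin ?V T"
  proof
    assume "openin ?V T"
    have B: "ball 0 1 \<in> ?M"
      by (simp add: region_space_def ball_mem_convex_regions)
    interpret B: bounded_open "ball (0 :: real ^ 'n) 1" using B by (rule region_space_bounded_open)
    have abs: "AE x in B.U. \<bar>x \<bullet> e\<bar> \<le> 1"
      using B.AE_mem
    proof eventually_elim
      case (elim x)
      then show ?case using Cauchy_Schwarz_ineq2[of x e] e by simp
    qed
    then have "AE x in B.U. x \<bullet> e \<le> 1" by eventually_elim simp
    with abs have "B.expectation (\<lambda>x. x \<bullet> e) \<le> 1"
      by (intro B.integral_le_const B.integrable_bounded) auto
    then have "ball 0 1 \<in> T" using B by (simp add: T_def)
    with \<open>openin ?V T\<close> have "\<exists>r>0. {Q \<in> ?M. symdiff_dist (ball 0 1) Q < r} \<subseteq> T"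
      unfolding openin_dist_topology by (elim conjE bspec)
    then obtain r where "0 < r" and r: "{Q \<in> ?M. symdiff_dist (ball 0 1) Q < r} \<subseteq> T"
      by (elim exE conjE)
    have "\<exists>\<epsilon>>0. measure lborel (ball (0 :: real ^ 'n) \<epsilon>) < r"
    proof (rule ex_small_measure_decseq)
      have "x = 0" if "\<And>n. x \<in> ball 0 (1 / Suc n)" for x :: "real ^ 'n"
      proof (rule ccontr)
        assume "x \<noteq> 0"
        then obtain n where "1 / Suc n < norm x" using nat_approx_posE[of "norm x"] by auto
        then show False using that[of n] by simp
      qed
      then have "(\<Inter>n. ball 0 (1 / Suc n)) \<subseteq> {0 :: real ^ 'n}" by blast
      then show "negligible (\<Inter>n. ball (0 :: real ^ 'n) (1 / Suc n))"
        using negligible_sing negligible_subset by blast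
    qed (use \<open>0 < r\<close> in \<open>auto intro: less_le_trans\<close>)
    then obtain \<rho>' where \<rho>': "0 < \<rho>'" "measure lborel (ball (0 :: real ^ 'n) \<rho>') < r" by blast
    define \<rho> where "\<rho> = min \<rho>' 1"
    have "measure lborel (ball (0 :: real ^ 'n) \<rho>) \<le> measure lborel (ball (0 :: real ^ 'n) \<rho>')"
      by (intro measure_mono_fmeasurable bounded_fmeasurable_lborel) (auto simp: \<rho>_def)
    moreover have "0 < \<rho>" "\<rho> \<le> 1" using \<rho>'(1) by (auto simp: \<rho>_def)
    moreover obtain Q where Q: "Q \<in> ?M" "symdiff_dist (ball 0 1) Q = measure lborel (ball (0 :: real ^ 'n) \<rho>)"
      and ge: "2 \<le> (LINT x|uniform_measure lborel Q. x \<bullet> e)"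
      using ball_with_distant_ball[OF e \<open>0 < \<rho>\<close> \<open>\<rho> \<le> 1\<close>] by blast
    ultimately have "Q \<in> T" using \<rho>'(2) r by auto
    then show False using ge by (simp add: T_def)
  qed
  ultimately show ?thesis
    using finer unfolding strictly_finer_def by blast
qed

end
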